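(* Let $N\ge1$ and $\gamma=(\gamma_1,\dots,\gamma_N)\in\mathbf{R}^N$. Let $\Gamma_c$ be the closure of the subgroup of $(\mathbf{S}^1)^N$ generated by the set $\{(e^{ix\gamma_1},\dots,e^{ix\gamma_N}):x\in\mathbf{R}\}$, and let $\lambda_c$ be its Haar probability measure. Let $x_0>0$. For all $X>x_0$, let $\nu_X$ be the probability measure on $(\mathbf{S}^1)^N$ defined by $$\int_{(\mathbf{S}^1)^N}h\,\mathrm{d}\nu_X=\frac1{X-x_0}\int_{x_0}^Xh(e^{ix\gamma_1},\dots,e^{ix\gamma_N})\,\mathrm{d}x\quad\text{for all continuous }h:(\mathbf{S}^1)^N\to\mathbf{C}.$$ Then for all $X>x_0$ and all $H\ge1$, $$\mathcal{W}_1(\nu_X,\lambda_c)\le\frac{4\sqrt3\sqrt N}{H}+\frac2{X-x_0}\left(\sum_{\substack{1\le\|m\|_\infty\le H\\ \langle m,\gamma\rangle\ne0}}\frac1{\|m\|_2^2\,\langle m,\gamma\rangle^2}\right)^{1/2},$$ where the sum runs over $m\in\mathbf{Z}^N$.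
   Context: $\mathbf{S}^1$ is the unit circle in $\mathbf{C}$ with arc-length metric $\ell(e^{i\alpha},e^{i\theta})=\min\{|\alpha-\theta|,2\pi-|\alpha-\theta|\}$ for $\alpha,\theta\in(-\pi,\pi]$, and $(\mathbf{S}^1)^N$ carries the metric $d(z,z')=(\sum_{j=1}^N\ell(z_j,z_j')^2)^{1/2}$. $\mathcal{W}_1$ is the 1-Wasserstein distance for this metric: $\mathcal{W}_1(\mu,\nu)=\inf_\pi\int d(x,y)\,\mathrm{d}\pi(x,y)$, the infimum being over couplings $\pi$ of $\mu$ and $\nu$. The measure $\lambda_c$ is identified with its pushforward to $(\mathbf{S}^1)^N$ under the inclusion. $\|m\|_\infty$ and $\|m\|_2$ are the sup and Euclidean norms, $\langle m,\gamma\rangle=\sum_jm_j\gamma_j$. *)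

theory Defs
  imports "HOL-Probability.Probability" "HOL-Algebra.Generated_Groups"
begin

definition torus :: "(complex ^ 'n) set" where
  "torus = {z. \<forall>j. z $ j \<in> sphere 0 1}"

text \<open>Multiplication of vectors in \<^typ>\<open>complex ^ 'n\<close> is componentwise.\<close>

definition torus_group :: "(complex ^ 'n) monoid" where
  "torus_group = \<lparr>carrier = torus, monoid.mult = (*), one = 1\<rparr>"

text \<open>\<^const>\<open>Arg\<close> takes values in the half-open interval from \<open>-pi\<close> (excluded)
  to \<open>pi\<close> (included).\<close>

definition arc_dist :: "complex \<Rightarrow> complex \<Rightarrow> real" where
  "arc_dist z w = min \<bar>Arg z - Arg w\<bar> (2 * pi - \<bar>Arg z - Arg w\<bar>)"

definition torus_dist :: "complex ^ 'n \<Rightarrow> complex ^ 'n \<Rightarrow> real" where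
  "torus_dist z w = sqrt (\<Sum>j\<in>UNIV. (arc_dist (z $ j) (w $ j))\<^sup>2)"

definition torus_borel :: "(complex ^ 'n) measure" where
  "torus_borel = restrict_space borel torus"

definition couplings :: "'a measure \<Rightarrow> 'b measure \<Rightarrow> ('a \<times> 'b) measure set" where
  "couplings \<mu> \<nu> =
    {\<pi>. prob_space \<pi> \<and> sets \<pi> = sets (\<mu> \<Otimes>\<^sub>M \<nu>) \<and>
        distr \<pi> \<mu> fst = \<mu> \<and> distr \<pi> \<nu> snd = \<nu>}"

definition wasserstein1 :: "('a \<Rightarrow> 'a \<Rightarrow> real) \<Rightarrow> 'a measure \<Rightarrow> 'a measure \<Rightarrow> ennreal" where
  "wasserstein1 d \<mu> \<nu> = (INF \<pi>\<in>couplings \<mu> \<nu>. \<integral>\<^sup>+ p. ennreal (d (fst p) (snd p)) \<partial>\<pi>)"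

text \<open>Intended for compact groups inside a second countable metric space, where every finite
  Borel measure is regular; a left Haar probability measure is then the same as a left-invariant
  Borel probability measure.\<close>

definition haar_prob_measure :: "('a :: topological_space, 'b) monoid_scheme \<Rightarrow> 'a measure \<Rightarrow> bool" where
  "haar_prob_measure G M \<longleftrightarrow>
    prob_space M \<and> sets M = sets (restrict_space borel (carrier G)) \<and>
    (\<forall>g\<in>carrier G. \<forall>A\<in>sets M. emeasure M (g <#\<^bsub>G\<^esub> A) = emeasure M A)"

definition exp_curve :: "real ^ 'n \<Rightarrow> real \<Rightarrow> complex ^ 'n" where
  "exp_curve \<gamma> x = (\<chi> j. exp (\<i> * complex_of_real (x * \<gamma> $ j)))"

definition closure_group :: "real ^ 'n \<Rightarrow> (complex ^ 'n) monoid" where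
  "closure_group \<gamma> = torus_group\<lparr>carrier := closure (generate torus_group (range (exp_curve \<gamma>)))\<rparr>"

definition int_lattice :: "(real ^ 'n) set" where
  "int_lattice = {m. \<forall>j. m $ j \<in> \<int>}"

end

theory Submission
  imports Defs
begin

text \<open>
  By finite Kantorovich duality and quantization, it suffices to bound
  \<open>\<integral>F d\<nu> - \<integral>F d\<lambda>\<close> for a 1-Lipschitz function \<open>F\<close> on the torus. Convolving \<open>F\<close> with a
  nonnegative trigonometric kernel of degree at most \<open>H\<close> in each variable changes it by at most
  \<open>2 sqrt 3 sqrt N / H\<close> and gives a trigonometric polynomial \<open>G = \<Sum> a\<^sub>m e\<^sub>m\<close> that is still
  1-Lipschitz. Hence \<open>|grad G| \<le> 1\<close> pointwise, so \<open>\<Sum> |m|\<^sup>2 |a\<^sub>m|\<^sup>2 \<le> 1\<close> by Parseval, and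
  Cauchy-Schwarz bounds \<open>\<integral>G d\<nu> - \<integral>G d\<lambda>\<close> by the \<open>l\<^sup>2\<close> norm of the differences of Fourier
  coefficients divided by \<open>|m|\<close>. These differences vanish if \<open>m\<close> is orthogonal to \<open>\<gamma>\<close> and are
  integrals of a nontrivial exponential otherwise.
\<close>

section \<open>Finite optimal transport\<close>

text \<open>\<open>wasserstein1\<close> asks for couplings, while Fourier analysis only bounds
  differences of integrals; duality bridges the two, and since only an infimum is bounded,
  near-optimal plans on finite nets suffice. Convolution makes a merely Lipschitz function
  accessible to Parseval: derivatives are taken of a polynomial only. The kernel decides the first
  term. A Fejer kernel has second moment of order 1/n, so the same argument would only yield 1/sqrt
  H; squared polynomials whose profile falls to zero at both ends reach 1/n^2. The squared angle has
  an infinite Fourier series; to make the moment computable it is dominated by the trigonometric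
  polynomial 2(1 - cos t) + 2(1 - cos t)^2. Its moment is at most 12/(n + 1)^2 per coordinate, so N
  coordinates move F by at most 2 sqrt 3 sqrt N/(n + 1). This is paid once for each of the two
  measures, whence 4 sqrt 3. The 2 before the second term counts the two end points of the primitive
  of a complex exponential.\<close>

lemma compact_simplex:
  assumes "finite A"
  shows "compact {p :: 'a \<Rightarrow> real. (\<forall>x. 0 \<le> p x) \<and> (\<forall>x. x \<notin> A \<longrightarrow> p x = 0) \<and> sum p A = 1}"
proof -
  \<comment> \<open>Weights are functions on the whole type, so compactness comes from Tychonoff;
    prescribing the value 0 outside \<open>A\<close> keeps every factor compact even if the type is
    infinite.\<close>
  define B where "B = PiE UNIV (\<lambda>x::'a. if x \<in> A then {0..1::real} else {0})"
  have "compactin (product_topology (\<lambda>_::'a. euclidean) UNIV) B"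
    unfolding B_def by (subst compactin_PiE) auto
  then have "compact B"
    by (simp add: euclidean_product_topology)
  moreover have "closed {p :: 'a \<Rightarrow> real. sum p A = 1}"
    by (intro closed_Collect_eq continuous_intros continuous_on_product_coordinates)
  ultimately have "compact (B \<inter> {p. sum p A = 1})"
    by (rule compact_Int_closed)
  moreover have "B \<inter> {p. sum p A = 1} =
      {p. (\<forall>x. 0 \<le> p x) \<and> (\<forall>x. x \<notin> A \<longrightarrow> p x = 0) \<and> sum p A = 1}"
  proof (intro equalityI subsetI)
    fix p :: "'a \<Rightarrow> real"
    assume p: "p \<in> {p. (\<forall>x. 0 \<le> p x) \<and> (\<forall>x. x \<notin> A \<longrightarrow> p x = 0) \<and> sum p A = 1}"
    then have "p x \<le> 1" if "x \<in> A" for x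
      using member_le_sum[of x A p] that assms by auto
    with p show "p \<in> B \<inter> {p. sum p A = 1}"
      by (auto simp: B_def PiE_iff)
  qed (auto simp: B_def PiE_iff split: if_splits)
  ultimately show ?thesis by simp
qed

text \<open>First-order optimality condition: the increment of a quadratic functional along a
  segment has this form, with \<open>2 * b\<close> the derivative at the starting point.\<close>

lemma quadratic_first_order:
  fixes b c :: real
  assumes "\<And>t. 0 < t \<Longrightarrow> t \<le> 1 \<Longrightarrow> 0 \<le> 2 * t * b + t\<^sup>2 * c"
  shows "0 \<le> b"
proof (rule ccontr)
  assume "\<not> 0 \<le> b"
  then have b: "b < 0" by simp
  \<comment> \<open>Chosen so that t (|c| + 1) is at most -b, which makes 2 b + t c at most b, a
    negative number.\<close>
  define t where "t = min 1 (- b / (\<bar>c\<bar> + 1))"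
  have t: "0 < t" "t \<le> 1" using b by (auto simp: t_def divide_neg_pos)
  have "0 \<le> t * (2 * b + t * c)" using assms[OF t] by (simp add: power2_eq_square algebra_simps)
  then have "0 \<le> 2 * b + t * c" using t by (simp add: zero_le_mult_iff)
  moreover have "t * c \<le> t * (\<bar>c\<bar> + 1)" using t by (intro mult_left_mono) auto
  moreover have "t * (\<bar>c\<bar> + 1) \<le> - b"
  proof -
    have "t \<le> (- b) / (\<bar>c\<bar> + 1)" unfolding t_def by (rule min.cobounded2)
    then show ?thesis by (subst (asm) pos_le_divide_eq) auto
  qed
  ultimately show False using b by linarith
qed

text \<open>Instead of a separation theorem, which would need a Euclidean space attached to the
  index set, the projection onto the cone of transport plans is computed by minimising the squared
  residual. If the minimum is positive, the residual is itself a dual certificate.\<close>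

lemma finite_transport_certificate:
  fixes a b :: "'a \<Rightarrow> real" and d :: "'a \<Rightarrow> 'a \<Rightarrow> real"
  assumes fin: "finite I"
    and a: "\<And>i. i \<in> I \<Longrightarrow> 0 \<le> a i" "sum a I = 1"
    and b: "\<And>i. i \<in> I \<Longrightarrow> 0 \<le> b i" "sum b I = 1"
  obtains (plan) p where "\<And>i j. 0 \<le> p i j"
      "\<And>i. i \<in> I \<Longrightarrow> (\<Sum>j\<in>I. p i j) = a i" "\<And>j. j \<in> I \<Longrightarrow> (\<Sum>i\<in>I. p i j) = b j"
      "(\<Sum>i\<in>I. \<Sum>j\<in>I. p i j * d i j) \<le> C"
  | (certificate) u v where "\<And>i j. i \<in> I \<Longrightarrow> j \<in> I \<Longrightarrow> u i + v j \<le> d i j"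
      "C < (\<Sum>i\<in>I. u i * a i) + (\<Sum>j\<in>I. v j * b j)"
proof -
  define S where "S = {p :: 'a \<times> 'a \<Rightarrow> real. (\<forall>x. 0 \<le> p x) \<and>
    (\<forall>x. x \<notin> I \<times> I \<longrightarrow> p x = 0) \<and> sum p (I \<times> I) = 1}"
  have cS: "compact S" unfolding S_def using fin by (intro compact_simplex) auto
  define r where "r p i = (\<Sum>j\<in>I. p (i, j)) - a i" for p :: "'a \<times> 'a \<Rightarrow> real" and i
  define s where "s p j = (\<Sum>i\<in>I. p (i, j)) - b j" for p :: "'a \<times> 'a \<Rightarrow> real" and j
  define c where "c p = (\<Sum>i\<in>I. \<Sum>j\<in>I. p (i, j) * d i j) - C" for p :: "'a \<times> 'a \<Rightarrow> real"
  \<comment> \<open>\<open>r\<close> and \<open>s\<close> are the errors in the two marginals. The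
    cost enters through its positive part because it is a one-sided constraint:
    \<open>Q p = 0\<close> says exactly that \<open>p\<close> is a plan of cost at most
    \<open>C\<close>.\<close>
  define Q where "Q p = (\<Sum>i\<in>I. (r p i)\<^sup>2) + (\<Sum>j\<in>I. (s p j)\<^sup>2) + (max 0 (c p))\<^sup>2" for p
  have contQ: "continuous_on S Q"
    unfolding Q_def r_def s_def c_def
    by (intro continuous_intros continuous_on_subset[OF continuous_on_product_coordinates]) auto
  have "(\<lambda>(i, j). if (i, j) \<in> I \<times> I then a i * b j else 0) \<in> S"
  proof -
    have "(\<Sum>x\<in>I\<times>I. case x of (i, j) \<Rightarrow> if (i, j) \<in> I \<times> I then a i * b j else 0) = (\<Sum>(i, j)\<in>I\<times>I. a i * b j)"
      by (intro sum.cong) auto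
    also have "\<dots> = sum a I * sum b I"
      by (simp add: sum_product sum.cartesian_product)
    finally show ?thesis using a b by (auto simp: S_def)
  qed
  then have "S \<noteq> {}" by auto
  then obtain p where p: "p \<in> S" and pmin: "\<And>q. q \<in> S \<Longrightarrow> Q p \<le> Q q"
    using continuous_attains_inf[OF cS _ contQ] by blast
  have p0: "0 \<le> p x" and pz: "x \<notin> I \<times> I \<Longrightarrow> p x = 0" and p1: "sum p (I \<times> I) = 1" for x
    using p unfolding S_def by blast+
  have sq: "0 \<le> (\<Sum>i\<in>I. (r p i)\<^sup>2)" "0 \<le> (\<Sum>j\<in>I. (s p j)\<^sup>2)" by (auto intro: sum_nonneg)
  show thesis
  proof (cases "Q p = 0")
    case True
    then have z: "(\<Sum>i\<in>I. (r p i)\<^sup>2) = 0" "(\<Sum>j\<in>I. (s p j)\<^sup>2) = 0" "(max 0 (c p))\<^sup>2 = 0"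
      using sq zero_le_power2[of "max 0 (c p)"] unfolding Q_def by linarith+
    have "r p i = 0" "s p i = 0" if "i \<in> I" for i
      using z(1,2) that fin by (auto simp: sum_nonneg_eq_0_iff)
    moreover have "c p \<le> 0" using z(3) by auto
    ultimately show thesis
      using p by (intro plan[of "\<lambda>i j. p (i, j)"]) (auto simp: S_def r_def s_def c_def)
  next
    case False
    define m where "m = max 0 (c p)"
    have Qpos: "Q p > 0" using False sq zero_le_power2[of "max 0 (c p)"] unfolding Q_def by linarith
    \<comment> \<open>Stationarity at the minimiser: the right side is half the one-sided derivative
      of \<open>Q\<close> from \<open>p\<close> towards the unit mass at (i, j).\<close>
    have key: "0 \<le> (r p i + s p j + m * (d i j - C)) - Q p - (\<Sum>i\<in>I. r p i * a i) - (\<Sum>j\<in>I. s p j * b j)"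
      if ij: "i \<in> I" "j \<in> I" for i j
    proof -
      define e where "e = (\<lambda>x. if x = (i, j) then 1 else 0 :: real)"
      define q where "q t x = p x + t * (e x - p x)" for t :: real and x
      have eI: "sum e (I \<times> I) = 1" using ij fin by (simp add: e_def)
      have e1: "(\<Sum>j'\<in>I. e (i', j')) = (if i' = i then 1 else 0)" for i'
        using ij fin by (simp add: e_def)
      have e2: "(\<Sum>i'\<in>I. e (i', j')) = (if j' = j then 1 else 0)" for j'
        using ij fin by (simp add: e_def)
      have e3: "(\<Sum>i'\<in>I. \<Sum>j'\<in>I. e (i', j') * d i' j') = d i j"
      proof -
        have "(\<Sum>i'\<in>I. \<Sum>j'\<in>I. e (i', j') * d i' j') = (\<Sum>x\<in>I\<times>I. if x = (i, j) then d i j else 0)"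
          unfolding sum.cartesian_product by (intro sum.cong) (auto simp: e_def split: if_splits)
        then show ?thesis using ij fin by simp
      qed
      have rq: "r (q t) i' = r p i' + t * ((if i' = i then 1 else 0) - a i' - r p i')" for t i'
        using e1[of i'] by (simp add: r_def q_def sum.distrib sum_subtractf flip: sum_distrib_left)
      have sq: "s (q t) j' = s p j' + t * ((if j' = j then 1 else 0) - b j' - s p j')" for t j'
        using e2[of j'] by (simp add: s_def q_def sum.distrib sum_subtractf flip: sum_distrib_left)
      have cq: "c (q t) = c p + t * (d i j - C - c p)" for t
      proof -
        have "(\<Sum>i\<in>I. \<Sum>j\<in>I. q t (i, j) * d i j) = (\<Sum>i\<in>I. \<Sum>j\<in>I. p (i, j) * d i j) +
          t * ((\<Sum>i'\<in>I. \<Sum>j'\<in>I. e (i', j') * d i' j') - (\<Sum>i\<in>I. \<Sum>j\<in>I. p (i, j) * d i j))"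
          by (simp add: q_def sum.distrib sum_subtractf sum_distrib_left algebra_simps)
        then show ?thesis unfolding e3 by (simp add: c_def algebra_simps)
      qed
      define R where "R i' = (if i' = i then 1 else 0) - a i' - r p i'" for i'
      define T where "T j' = (if j' = j then 1 else 0) - b j' - s p j'" for j'
      define W where "W = d i j - C - c p"
      define B where "B = (\<Sum>i\<in>I. r p i * R i) + (\<Sum>j\<in>I. s p j * T j) + m * W"
      define Z where "Z = (\<Sum>i\<in>I. (R i)\<^sup>2) + (\<Sum>j\<in>I. (T j)\<^sup>2) + W\<^sup>2"
      have "0 \<le> 2 * t * B + t\<^sup>2 * Z" if t: "0 < t" "t \<le> 1" for t
      proof -
        have "0 \<le> q t x" for x
        proof -
          have "q t x = (1 - t) * p x + t * e x" by (simp add: q_def algebra_simps)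
          moreover have "0 \<le> (1 - t) * p x" "0 \<le> t * e x" using t p0 by (simp_all add: e_def)
          ultimately show ?thesis by linarith
        qed
        moreover have "sum (q t) (I \<times> I) = 1"
          using p1 eI by (simp add: q_def sum.distrib sum_subtractf flip: sum_distrib_left)
        moreover have "q t x = 0" if "x \<notin> I \<times> I" for x
          using that pz[OF that] ij by (auto simp: q_def e_def)
        ultimately have "q t \<in> S" unfolding S_def by blast
        then have "Q p \<le> Q (q t)" by (rule pmin)
        \<comment> \<open>The squared positive part is not a polynomial. As \<open>m\<close> is the
          positive part of \<open>c p\<close>, passing to the square of \<open>m + t * W\<close>
          only increases the value and is exact at t = 0, so the condition for quadratics
          applies.\<close>
        also have "Q (q t) \<le> (\<Sum>i\<in>I. (r p i + t * R i)\<^sup>2) + (\<Sum>j\<in>I. (s p j + t * T j)\<^sup>2) + (m + t * W)\<^sup>2"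
        proof -
          have "(max 0 (c p + t * W))\<^sup>2 \<le> (m + t * W)\<^sup>2"
            by (rule abs_le_square_iff[THEN iffD1]) (auto simp: m_def)
          then show ?thesis by (simp add: Q_def rq sq cq R_def T_def W_def)
        qed
        also have "\<dots> = Q p + (2 * t * B + t\<^sup>2 * Z)"
          by (simp add: Q_def B_def Z_def m_def power2_sum power_mult_distrib sum.distrib
              sum_distrib_left algebra_simps)
        finally show ?thesis by simp
      qed
      then have "0 \<le> B" by (rule quadratic_first_order)
      moreover have "(\<Sum>i'\<in>I. r p i' * R i') = r p i - (\<Sum>i\<in>I. r p i * a i) - (\<Sum>i\<in>I. (r p i)\<^sup>2)"
      proof -
        have "r p i' * R i' = (if i' = i then r p i' else 0) - r p i' * a i' - (r p i')\<^sup>2" for i'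
          by (simp add: R_def algebra_simps power2_eq_square)
        then show ?thesis using ij fin by (simp add: sum_subtractf)
      qed
      moreover have "(\<Sum>j'\<in>I. s p j' * T j') = s p j - (\<Sum>j\<in>I. s p j * b j) - (\<Sum>j\<in>I. (s p j)\<^sup>2)"
      proof -
        have "s p j' * T j' = (if j' = j then s p j' else 0) - s p j' * b j' - (s p j')\<^sup>2" for j'
          by (simp add: T_def algebra_simps power2_eq_square)
        then show ?thesis using ij fin by (simp add: sum_subtractf)
      qed
      moreover have "m * W = m * (d i j - C) - m\<^sup>2"
        by (simp add: W_def m_def max_def power2_eq_square algebra_simps)
      ultimately show ?thesis by (simp add: B_def Q_def m_def)
    qed
    define D where "D = (\<Sum>i\<in>I. r p i * a i) + (\<Sum>j\<in>I. s p j * b j)"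
    have key': "Q p + D \<le> r p i + s p j + m * (d i j - C)" if "i \<in> I" "j \<in> I" for i j
      using key[OF that] by (simp add: D_def)
    have av: "(\<Sum>i\<in>I. \<Sum>j\<in>I. a i * b j * (r p i + s p j)) = D"
    proof -
      have "(\<Sum>i\<in>I. \<Sum>j\<in>I. a i * b j * (r p i + s p j)) =
        (\<Sum>i\<in>I. r p i * a i) * sum b I + sum a I * (\<Sum>j\<in>I. s p j * b j)"
        unfolding sum_product by (simp add: sum.distrib[symmetric] algebra_simps)
      then show ?thesis using a b by (simp add: D_def)
    qed
    \<comment> \<open>The product plan has the right marginals, so marginal errors alone cannot
      obstruct: without a cost residual, averaging \<open>key'\<close> with the weights
      \<open>a i * b j\<close> would give \<open>Q p + D \<le> D\<close>.\<close>
    have "m \<noteq> 0"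
    proof
      assume m: "m = 0"
      have "(\<Sum>i\<in>I. \<Sum>j\<in>I. a i * b j * (Q p + D)) \<le> (\<Sum>i\<in>I. \<Sum>j\<in>I. a i * b j * (r p i + s p j))"
        using key' a b by (intro sum_mono mult_left_mono) (auto simp: m)
      moreover have "(\<Sum>i\<in>I. \<Sum>j\<in>I. a i * b j * (Q p + D)) = Q p + D"
        using a b by (simp add: flip: sum_distrib_left sum_distrib_right)
      ultimately show False using Qpos av by simp
    qed
    then have m: "m > 0" by (simp add: m_def)
    \<comment> \<open>Division of \<open>key'\<close> by \<open>m\<close> turns residuals into
      potentials; the normalising constant is put into the first one. The dual value then exceeds
      \<open>C\<close> by exactly \<open>Q p / m\<close>.\<close>
    define k where "k = (Q p + D) / m + C"
    show thesis
    proof (rule certificate[of "\<lambda>i. - r p i / m + k" "\<lambda>j. - s p j / m"])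
      fix i j assume "i \<in> I" "j \<in> I"
      from key'[OF this] have "(Q p + D) / m \<le> (r p i + s p j + m * (d i j - C)) / m"
        using m by (simp add: divide_right_mono)
      also have "\<dots> = r p i / m + s p j / m + d i j - C" using m by (simp add: field_simps)
      finally show "- r p i / m + k + - s p j / m \<le> d i j" by (simp add: k_def)
    next
      have "(\<Sum>i\<in>I. (- r p i / m + k) * a i) + (\<Sum>j\<in>I. - s p j / m * b j) = k * sum a I - D / m"
        by (simp add: D_def algebra_simps sum.distrib sum_subtractf sum_negf sum_divide_distrib
            add_divide_distrib sum_distrib_left)
      also have "\<dots> = C + Q p / m" using a by (simp add: k_def add_divide_distrib)
      finally show "C < (\<Sum>i\<in>I. (- r p i / m + k) * a i) + (\<Sum>j\<in>I. - s p j / m * b j)"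
        using m Qpos by simp
    qed
  qed
qed

text \<open>The certificate has two potentials; the minimum over j of \<open>d i j - v j\<close>
  replaces both. It lies above \<open>u\<close> because the pair is admissible, below
  \<open>-v\<close> because \<open>d\<close> vanishes on the diagonal, and it is 1-Lipschitz by the
  triangle inequality, so \<open>dual\<close> contradicts the certificate.\<close>

lemma finite_kantorovich:
  fixes a b :: "'a \<Rightarrow> real" and d :: "'a \<Rightarrow> 'a \<Rightarrow> real"
  assumes fin: "finite I"
    and a: "\<And>i. i \<in> I \<Longrightarrow> 0 \<le> a i" "sum a I = 1"
    and b: "\<And>i. i \<in> I \<Longrightarrow> 0 \<le> b i" "sum b I = 1"
    and d0: "\<And>i. i \<in> I \<Longrightarrow> d i i = 0"
    and tri: "\<And>i j k. i \<in> I \<Longrightarrow> j \<in> I \<Longrightarrow> k \<in> I \<Longrightarrow> d i k \<le> d i j + d j k"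
    and dual: "\<And>f. (\<And>i j. i \<in> I \<Longrightarrow> j \<in> I \<Longrightarrow> f i - f j \<le> d i j) \<Longrightarrow>
      (\<Sum>i\<in>I. f i * a i) - (\<Sum>i\<in>I. f i * b i) \<le> C"
  obtains p where "\<And>i j. 0 \<le> p i j"
      "\<And>i. i \<in> I \<Longrightarrow> (\<Sum>j\<in>I. p i j) = a i" "\<And>j. j \<in> I \<Longrightarrow> (\<Sum>i\<in>I. p i j) = b j"
      "(\<Sum>i\<in>I. \<Sum>j\<in>I. p i j * d i j) \<le> C"
proof (rule finite_transport_certificate[where a = a and b = b and d = d and I = I and C = C])
  fix u v assume uv: "\<And>i j. i \<in> I \<Longrightarrow> j \<in> I \<Longrightarrow> u i + v j \<le> d i j"
    and big: "C < (\<Sum>i\<in>I. u i * a i) + (\<Sum>j\<in>I. v j * b j)"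
  have ne: "I \<noteq> {}" using a by auto
  define f where "f i = (MIN j\<in>I. d i j - v j)" for i
  have f_le: "f i \<le> d i j - v j" if "j \<in> I" for i j
    unfolding f_def using fin that by (intro Min_le) auto
  have f_ge: "x \<le> f i" if "\<And>j. j \<in> I \<Longrightarrow> x \<le> d i j - v j" for x i
    unfolding f_def using fin ne that by (intro Min.boundedI) auto
  have "(\<Sum>i\<in>I. f i * a i) - (\<Sum>i\<in>I. f i * b i) \<le> C"
  proof (rule dual)
    fix i k assume ik: "i \<in> I" "k \<in> I"
    have "f i - d i k \<le> f k"
    proof (rule f_ge)
      fix j assume "j \<in> I"
      then show "f i - d i k \<le> d k j - v j" using f_le[of j i] tri[of i k j] ik by simp
    qed
    then show "f i - f k \<le> d i k" by simp
  qed
  moreover have "(\<Sum>i\<in>I. u i * a i) \<le> (\<Sum>i\<in>I. f i * a i)"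
    using uv a by (intro sum_mono mult_right_mono f_ge) (auto simp: algebra_simps)
  moreover have "(\<Sum>i\<in>I. f i * b i) \<le> (\<Sum>i\<in>I. - v i * b i)"
  proof (intro sum_mono mult_right_mono)
    fix i assume "i \<in> I" then show "f i \<le> - v i" using f_le[of i i] d0 by simp
  qed (use b in auto)
  ultimately show thesis using big by (simp add: sum_negf)
qed (use assms in \<open>auto intro: that\<close>)

section \<open>Kantorovich duality on totally bounded spaces\<close>

text \<open>Balls around the net points become disjoint cells by letting each newly inserted point
  take over its whole ball. With \<open>count_space UNIV\<close> as target, every function of the
  cell label is measurable.\<close>

lemma ex_measurable_quantizer:
  fixes d :: "'a \<Rightarrow> 'a \<Rightarrow> real"
  assumes "finite P" "P \<subseteq> space M"
    and meas: "\<And>p. p \<in> space M \<Longrightarrow> (\<lambda>x. d x p) \<in> borel_measurable M"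
  shows "\<exists>r. r \<in> measurable M (count_space UNIV) \<and>
    (\<forall>x. (\<exists>p\<in>P. d x p \<le> e) \<longrightarrow> r x \<in> P \<and> d x (r x) \<le> e)"
  using assms(1,2)
proof (induction P rule: finite_induct)
  case empty
  then show ?case by (auto intro!: exI[of _ "\<lambda>_. undefined"])
next
  case (insert p P)
  then obtain r where r: "r \<in> measurable M (count_space UNIV)"
    "\<And>x. (\<exists>p\<in>P. d x p \<le> e) \<Longrightarrow> r x \<in> P \<and> d x (r x) \<le> e"
    by auto
  have [measurable]: "(\<lambda>x. d x p) \<in> borel_measurable M" using insert meas by auto
  have "(\<lambda>x. if d x p \<le> e then p else r x) \<in> measurable M (count_space UNIV)"
    using r(1) by measurable
  then show ?case using r(2)
    by (intro exI[of _ "\<lambda>x. if d x p \<le> e then p else r x"]) auto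
qed

text \<open>Stated over a semiring so that the same expansion into cells serves
  \<open>ennreal\<close> and real integrands.\<close>

lemma quantized_sum:
  fixes u :: "'b \<Rightarrow> 'c::semiring_1"
  assumes "finite P" "r x \<in> P" "x \<in> X"
  shows "u (r x) = (\<Sum>p\<in>P. u p * indicator {y \<in> X. r y = p} x)"
proof -
  have "(\<Sum>p\<in>P. u p * indicator {y \<in> X. r y = p} x) = (\<Sum>p\<in>P. if p = r x then u p else 0)"
    using assms by (intro sum.cong) (auto simp: indicator_def)
  then show ?thesis using assms by simp
qed

lemma nn_integral_quantized:
  fixes u :: "'b \<Rightarrow> ennreal"
  assumes r: "r \<in> measurable M (count_space UNIV)" and P: "finite P" "\<And>x. x \<in> space M \<Longrightarrow> r x \<in> P"
  shows "(\<integral>\<^sup>+ x. u (r x) \<partial>M) = (\<Sum>p\<in>P. u p * emeasure M {x \<in> space M. r x = p})"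
proof -
  have [measurable]: "{x \<in> space M. r x = p} \<in> sets M" for p
    using r by measurable
  have "(\<integral>\<^sup>+ x. u (r x) \<partial>M) = (\<integral>\<^sup>+ x. (\<Sum>p\<in>P. u p * indicator {y \<in> space M. r y = p} x) \<partial>M)"
    using P by (intro nn_integral_cong quantized_sum)
  also have "\<dots> = (\<Sum>p\<in>P. u p * emeasure M {x \<in> space M. r x = p})"
    by (subst nn_integral_sum) (auto intro!: sum.cong simp: nn_integral_cmult_indicator)
  finally show ?thesis .
qed

lemma (in finite_measure) integral_quantized:
  fixes u :: "'b \<Rightarrow> real"
  assumes r: "r \<in> measurable M (count_space UNIV)" and P: "finite P" "\<And>x. x \<in> space M \<Longrightarrow> r x \<in> P"
  shows "integrable M (\<lambda>x. u (r x))"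
    and "(\<integral>x. u (r x) \<partial>M) = (\<Sum>p\<in>P. u p * measure M {x \<in> space M. r x = p})"
proof -
  have [measurable]: "{x \<in> space M. r x = p} \<in> sets M" for p
    using r by measurable
  have *: "u (r x) = (\<Sum>p\<in>P. u p * indicator {y \<in> space M. r y = p} x)" if "x \<in> space M" for x
    using P that by (intro quantized_sum)
  have int: "integrable M (\<lambda>x. \<Sum>p\<in>P. u p * indicator {y \<in> space M. r y = p} x)"
    by (intro Bochner_Integration.integrable_sum integrable_mult_right integrable_real_indicator)
      (auto simp: emeasure_finite less_top[symmetric])
  then show "integrable M (\<lambda>x. u (r x))"
    using * by (simp cong: Bochner_Integration.integrable_cong)
  have "(\<integral>x. u (r x) \<partial>M) = (\<integral>x. (\<Sum>p\<in>P. u p * indicator {y \<in> space M. r y = p} x) \<partial>M)"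
    using * by (intro Bochner_Integration.integral_cong) auto
  also have "\<dots> = (\<Sum>p\<in>P. u p * measure M {x \<in> space M. r x = p})"
    by (subst Bochner_Integration.integral_sum)
      (auto intro!: integrable_mult_right integrable_real_indicator simp: emeasure_finite less_top[symmetric])
  finally show "(\<integral>x. u (r x) \<partial>M) = (\<Sum>p\<in>P. u p * measure M {x \<in> space M. r x = p})" .
qed

text \<open>The lifted coupling divides by cell masses; this confines the cells where the division
  degenerates to a null set.\<close>

lemma AE_quantized_pos:
  assumes r: "r \<in> measurable M (count_space UNIV)" and P: "finite P" "\<And>x. x \<in> space M \<Longrightarrow> r x \<in> P"
  shows "AE x in M. emeasure M {y \<in> space M. r y = r x} \<noteq> 0"
proof -
  have [measurable]: "{x \<in> space M. r x = p} \<in> sets M" for p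
    using r by measurable
  have "AE x in M. \<forall>p\<in>P. emeasure M {y \<in> space M. r y = p} = 0 \<longrightarrow> r x \<noteq> p"
  proof (subst AE_finite_all[OF P(1)], intro ballI)
    fix p assume "p \<in> P"
    show "AE x in M. emeasure M {y \<in> space M. r y = p} = 0 \<longrightarrow> r x \<noteq> p"
    proof (cases "emeasure M {y \<in> space M. r y = p} = 0")
      case True
      then show ?thesis by (intro AE_I[of _ _ "{y \<in> space M. r y = p}"]) auto
    qed auto
  qed
  then show ?thesis by (rule AE_mp) (use P(2) in auto)
qed

text \<open>A transport plan between the quantized measures lifts to a coupling of the original ones:
  within each pair of cells, mass is spread according to the product measure.\<close>

lemma ex_coupling_of_quantized:
  fixes M N :: "'a measure" and p :: "'b \<Rightarrow> 'b \<Rightarrow> real"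
  assumes "prob_space M" "prob_space N"
    and rM: "r \<in> measurable M (count_space UNIV)" and rN: "r \<in> measurable N (count_space UNIV)"
    and P: "finite P" "\<And>x. x \<in> space M \<Longrightarrow> r x \<in> P" "\<And>x. x \<in> space N \<Longrightarrow> r x \<in> P"
    and p0: "\<And>i j. 0 \<le> p i j"
    and m1: "\<And>i. i \<in> P \<Longrightarrow> (\<Sum>j\<in>P. p i j) = measure M {x \<in> space M. r x = i}"
    and m2: "\<And>j. j \<in> P \<Longrightarrow> (\<Sum>i\<in>P. p i j) = measure N {x \<in> space N. r x = j}"
  obtains \<pi> where "\<pi> \<in> couplings M N"
    "\<And>u :: 'b \<Rightarrow> 'b \<Rightarrow> ennreal. (\<integral>\<^sup>+ z. u (r (fst z)) (r (snd z)) \<partial>\<pi>) = (\<Sum>i\<in>P. \<Sum>j\<in>P. u i j * ennreal (p i j))"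
proof -
  interpret M: prob_space M by fact
  interpret N: prob_space N by fact
  interpret MN: pair_prob_space M N ..
  define a where "a i = measure M {x \<in> space M. r x = i}" for i
  define b where "b i = measure N {x \<in> space N. r x = i}" for i
  \<comment> \<open>Density of the lift with respect to the product measure. Division by a null cell
    gives 0, and \<open>pz\<close> shows that no mass is lost there.\<close>
  define q where "q i j = p i j / (a i * b j)" for i j
  have pos: "0 \<le> a i" "0 \<le> b i" "0 \<le> q i j" for i j
    by (auto simp: a_def b_def q_def p0)
  have pz: "p i j = 0" if "i \<in> P" "j \<in> P" "a i = 0 \<or> b j = 0" for i j
    using that m1[of i] m2[of j] p0 P(1) by (auto simp: a_def b_def sum_nonneg_eq_0_iff)
  have pq: "q i j * a i * b j = p i j" if "i \<in> P" "j \<in> P" for i j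
    using pz[OF that] by (auto simp: q_def)
  have qa: "(\<Sum>j\<in>P. q i j * b j) = 1" if "i \<in> P" "a i \<noteq> 0" for i
  proof -
    have "(\<Sum>j\<in>P. q i j * b j) * a i = (\<Sum>j\<in>P. p i j)"
      unfolding sum_distrib_right using that pq[of i] by (intro sum.cong) (auto simp: algebra_simps)
    then show ?thesis using that m1 by (simp add: a_def)
  qed
  have qb: "(\<Sum>i\<in>P. q i j * a i) = 1" if "j \<in> P" "b j \<noteq> 0" for j
  proof -
    have "(\<Sum>i\<in>P. q i j * a i) * b j = (\<Sum>i\<in>P. p i j)"
      unfolding sum_distrib_right using that pq[of _ j] by (intro sum.cong) (auto simp: algebra_simps)
    then show ?thesis using that m2 by (simp add: b_def)
  qed
  have eM: "emeasure M {x \<in> space M. r x = i} = ennreal (a i)" for i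
    by (simp add: a_def M.emeasure_eq_measure)
  have eN: "emeasure N {x \<in> space N. r x = i} = ennreal (b i)" for i
    by (simp add: b_def N.emeasure_eq_measure)
  have iN: "(\<integral>\<^sup>+ y. u (r y) \<partial>N) = (\<Sum>j\<in>P. u j * ennreal (b j))" for u
    using rN P by (simp add: nn_integral_quantized eN)
  have iM: "(\<integral>\<^sup>+ x. u (r x) \<partial>M) = (\<Sum>i\<in>P. u i * ennreal (a i))" for u
    using rM P by (simp add: nn_integral_quantized eM)
  \<comment> \<open>The labels form a possibly uncountable type, on which a function of two labels
    need not be measurable for the product of the discrete sigma-algebras. A finite expansion in the
    first label avoids this.\<close>
  have [measurable]: "(\<lambda>z. g (r (fst z)) (r (snd z))) \<in> borel_measurable (M \<Otimes>\<^sub>M N)" for g :: "'b \<Rightarrow> 'b \<Rightarrow> ennreal"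
  proof -
    have "(\<lambda>z. \<Sum>i\<in>P. g i (r (snd z)) * indicator {x \<in> space M. r x = i} (fst z)) \<in> borel_measurable (M \<Otimes>\<^sub>M N)"
    proof (intro borel_measurable_sum borel_measurable_times_ennreal)
      fix i
      have "(\<lambda>y. g i (r y)) \<in> borel_measurable N"
        using rN by (rule measurable_compose) simp
      then show "(\<lambda>z. g i (r (snd z))) \<in> borel_measurable (M \<Otimes>\<^sub>M N)" by measurable
      have "{x \<in> space M. r x = i} \<in> sets M" using rM by measurable
      then show "(\<lambda>z. indicator {x \<in> space M. r x = i} (fst z) :: ennreal) \<in> borel_measurable (M \<Otimes>\<^sub>M N)"
        by measurable
    qed
    moreover have "g (r (fst z)) (r (snd z)) = (\<Sum>i\<in>P. g i (r (snd z)) * indicator {x \<in> space M. r x = i} (fst z))"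
      if "z \<in> space (M \<Otimes>\<^sub>M N)" for z
      using P that by (intro quantized_sum) (auto simp: space_pair_measure)
    ultimately show ?thesis by (simp cong: measurable_cong)
  qed
  define \<pi> where "\<pi> = density (M \<Otimes>\<^sub>M N) (\<lambda>z. ennreal (q (r (fst z)) (r (snd z))))"
  have sp[measurable_cong]: "sets \<pi> = sets (M \<Otimes>\<^sub>M N)" by (simp add: \<pi>_def)
  have sum1: "(\<Sum>j\<in>P. ennreal (q i j) * ennreal (b j)) = 1" if "i \<in> P" "a i \<noteq> 0" for i
    using qa[OF that] pos by (simp add: sum_ennreal flip: ennreal_mult)
  have sum2: "(\<Sum>i\<in>P. ennreal (q i j) * ennreal (a i)) = 1" if "j \<in> P" "b j \<noteq> 0" for j
    using qb[OF that] pos by (simp add: sum_ennreal flip: ennreal_mult)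
  have d1: "distr \<pi> M fst = M"
  proof (rule measure_eqI)
    fix A assume "A \<in> sets (distr \<pi> M fst)"
    then have A[measurable]: "A \<in> sets M" by simp
    have "emeasure (distr \<pi> M fst) A = (\<integral>\<^sup>+ z. indicator A (fst z) \<partial>\<pi>)"
      by (subst nn_integral_distr[symmetric, of fst \<pi> M]) (simp_all)
    also have "\<dots> = (\<integral>\<^sup>+ z. ennreal (q (r (fst z)) (r (snd z))) * indicator A (fst z) \<partial>(M \<Otimes>\<^sub>M N))"
      unfolding \<pi>_def by (rule nn_integral_density) simp_all
    also have "\<dots> = (\<integral>\<^sup>+ x. (\<integral>\<^sup>+ y. ennreal (q (r x) (r y)) * indicator A x \<partial>N) \<partial>M)"
      by (subst N.nn_integral_fst[symmetric]) simp_all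
    also have "\<dots> = (\<integral>\<^sup>+ x. indicator A x \<partial>M)"
    proof (rule nn_integral_cong_AE)
      have "AE x in M. a (r x) \<noteq> 0"
        using AE_quantized_pos[OF rM P(1,2)] unfolding eM by (rule AE_mp) auto
      then show "AE x in M. (\<integral>\<^sup>+ y. ennreal (q (r x) (r y)) * indicator A x \<partial>N) = indicator A x"
      proof (rule AE_mp, intro AE_I2 impI)
        fix x assume x: "x \<in> space M" "a (r x) \<noteq> 0"
        have "(\<integral>\<^sup>+ y. ennreal (q (r x) (r y)) * indicator A x \<partial>N) =
            (\<Sum>j\<in>P. ennreal (q (r x) j) * indicator A x * ennreal (b j))"
          by (rule iN)
        also have "\<dots> = indicator A x * (\<Sum>j\<in>P. ennreal (q (r x) j) * ennreal (b j))"
          by (simp add: sum_distrib_left mult_ac)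
        finally show "(\<integral>\<^sup>+ y. ennreal (q (r x) (r y)) * indicator A x \<partial>N) = indicator A x"
          using sum1[of "r x"] x P by simp
      qed
    qed
    finally show "emeasure (distr \<pi> M fst) A = emeasure M A" by simp
  qed simp
  have d2: "distr \<pi> N snd = N"
  proof (rule measure_eqI)
    fix A assume "A \<in> sets (distr \<pi> N snd)"
    then have A[measurable]: "A \<in> sets N" by simp
    have "emeasure (distr \<pi> N snd) A = (\<integral>\<^sup>+ z. indicator A (snd z) \<partial>\<pi>)"
      by (subst nn_integral_distr[symmetric, of snd \<pi> N]) (simp_all)
    also have "\<dots> = (\<integral>\<^sup>+ z. ennreal (q (r (fst z)) (r (snd z))) * indicator A (snd z) \<partial>(M \<Otimes>\<^sub>M N))"
      unfolding \<pi>_def by (rule nn_integral_density) simp_all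
    also have "\<dots> = (\<integral>\<^sup>+ y. (\<integral>\<^sup>+ x. ennreal (q (r x) (r y)) * indicator A y \<partial>M) \<partial>N)"
      by (subst MN.nn_integral_snd[symmetric]) (simp_all add: case_prod_beta)
    also have "\<dots> = (\<integral>\<^sup>+ y. indicator A y \<partial>N)"
    proof (rule nn_integral_cong_AE)
      have "AE y in N. b (r y) \<noteq> 0"
        using AE_quantized_pos[OF rN P(1,3)] unfolding eN by (rule AE_mp) auto
      then show "AE y in N. (\<integral>\<^sup>+ x. ennreal (q (r x) (r y)) * indicator A y \<partial>M) = indicator A y"
      proof (rule AE_mp, intro AE_I2 impI)
        fix y assume y: "y \<in> space N" "b (r y) \<noteq> 0"
        have "(\<integral>\<^sup>+ x. ennreal (q (r x) (r y)) * indicator A y \<partial>M) =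
            (\<Sum>i\<in>P. ennreal (q i (r y)) * indicator A y * ennreal (a i))"
          by (rule iM)
        also have "\<dots> = indicator A y * (\<Sum>i\<in>P. ennreal (q i (r y)) * ennreal (a i))"
          by (simp add: sum_distrib_left mult_ac)
        finally show "(\<integral>\<^sup>+ x. ennreal (q (r x) (r y)) * indicator A y \<partial>M) = indicator A y"
          using sum2[of "r y"] y P by simp
      qed
    qed
    finally show "emeasure (distr \<pi> N snd) A = emeasure N A" by simp
  qed simp
  have "emeasure \<pi> (space \<pi>) = emeasure (distr \<pi> M fst) (space M)"
  proof -
    have "fst -` space M \<inter> space \<pi> = space \<pi>"
      using sets_eq_imp_space_eq[OF sp] by (auto simp: space_pair_measure)
    then show ?thesis by (subst emeasure_distr) simp_all
  qed
  then have "prob_space \<pi>" by (intro prob_spaceI) (simp add: d1 M.emeasure_space_1)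
  then have "\<pi> \<in> couplings M N" using sp d1 d2 by (simp add: couplings_def)
  moreover have "(\<integral>\<^sup>+ z. u (r (fst z)) (r (snd z)) \<partial>\<pi>) = (\<Sum>i\<in>P. \<Sum>j\<in>P. u i j * ennreal (p i j))"
    for u :: "'b \<Rightarrow> 'b \<Rightarrow> ennreal"
  proof -
    have "(\<integral>\<^sup>+ z. u (r (fst z)) (r (snd z)) \<partial>\<pi>) =
      (\<integral>\<^sup>+ z. ennreal (q (r (fst z)) (r (snd z))) * u (r (fst z)) (r (snd z)) \<partial>(M \<Otimes>\<^sub>M N))"
      unfolding \<pi>_def by (rule nn_integral_density) simp_all
    also have "\<dots> = (\<integral>\<^sup>+ x. (\<integral>\<^sup>+ y. ennreal (q (r x) (r y)) * u (r x) (r y) \<partial>N) \<partial>M)"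
      by (subst N.nn_integral_fst[symmetric]) simp_all
    also have "\<dots> = (\<Sum>i\<in>P. (\<Sum>j\<in>P. ennreal (q i j) * u i j * ennreal (b j)) * ennreal (a i))"
      by (subst iN) (rule iM)
    also have "\<dots> = (\<Sum>i\<in>P. \<Sum>j\<in>P. u i j * ennreal (q i j * a i * b j))"
      using pos by (simp add: sum_distrib_left ennreal_mult mult_ac)
    also have "\<dots> = (\<Sum>i\<in>P. \<Sum>j\<in>P. u i j * ennreal (p i j))"
      using pq by (intro sum.cong) auto
    finally show ?thesis .
  qed
  ultimately show thesis by (rule that)
qed

text \<open>One quantizer discretises both measures, the finite problem is solved on the net, and
  its plan is lifted back. Measurability is asked of \<open>d\<close> in one variable at a time,
  because the lifted cost is compared with a function of the two cells.\<close>

theorem wasserstein1_le_of_lipschitz: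
  fixes M N :: "'a measure" and d :: "'a \<Rightarrow> 'a \<Rightarrow> real"
  assumes PM: "prob_space M" and PN: "prob_space N" and sets: "sets N = sets M"
    and nonneg: "\<And>x y. 0 \<le> d x y" and refl: "\<And>x. d x x = 0" and sym: "\<And>x y. d x y = d y x"
    and tri: "\<And>x y z. x \<in> space M \<Longrightarrow> y \<in> space M \<Longrightarrow> z \<in> space M \<Longrightarrow> d x z \<le> d x y + d y z"
    and meas: "\<And>p. p \<in> space M \<Longrightarrow> (\<lambda>x. d x p) \<in> borel_measurable M"
    and net: "\<And>e. 0 < e \<Longrightarrow> \<exists>P. finite P \<and> P \<subseteq> space M \<and> (\<forall>x\<in>space M. \<exists>p\<in>P. d x p \<le> e)"
    and dual: "\<And>F. (\<And>x y. x \<in> space M \<Longrightarrow> y \<in> space M \<Longrightarrow> F x - F y \<le> d x y) \<Longrightarrow>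
      F \<in> borel_measurable M \<Longrightarrow> (\<integral>x. F x \<partial>M) - (\<integral>x. F x \<partial>N) \<le> C"
  shows "wasserstein1 d M N \<le> ennreal C"
proof (rule ennreal_le_epsilon)
  fix \<epsilon>::real assume \<epsilon>: "0 < \<epsilon>"
  interpret M: prob_space M by fact
  interpret N: prob_space N by fact
  note [measurable_cong] = sets
  have spN: "space N = space M" using sets by (rule sets_eq_imp_space_eq)
  have "C \<ge> 0" using dual[of "\<lambda>_. 0"] nonneg by simp
  \<comment> \<open>Four errors of size \<open>e\<close> add up to \<open>\<epsilon>\<close>: two
    when the integrals of a test function are read off the net, two when the cost is.\<close>
  define e where "e = \<epsilon> / 4"
  have e: "e > 0" using \<epsilon> by (simp add: e_def)
  obtain P where P: "finite P" "P \<subseteq> space M" "\<And>x. x \<in> space M \<Longrightarrow> \<exists>p\<in>P. d x p \<le> e"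
    using net[OF e] by blast
  obtain r where rM: "r \<in> measurable M (count_space UNIV)"
    and r: "\<And>x. x \<in> space M \<Longrightarrow> r x \<in> P" "\<And>x. x \<in> space M \<Longrightarrow> d x (r x) \<le> e"
    using ex_measurable_quantizer[of P M d e] P meas by metis
  have rN: "r \<in> measurable N (count_space UNIV)" using rM by measurable
  define a where "a i = measure M {x \<in> space M. r x = i}" for i
  define b where "b i = measure N {x \<in> space N. r x = i}" for i
  have ia: "integrable M (\<lambda>x. f (r x))" "(\<integral>x. f (r x) \<partial>M) = (\<Sum>i\<in>P. f i * a i)" for f
    unfolding a_def using M.integral_quantized[OF rM P(1) r(1)] by auto
  have ib: "integrable N (\<lambda>x. f (r x))" "(\<integral>x. f (r x) \<partial>N) = (\<Sum>i\<in>P. f i * b i)" for f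
    unfolding b_def using N.integral_quantized[OF rN P(1) r(1)] spN by auto
  have sa: "sum a P = 1" using ia(2)[of "\<lambda>_. 1"] by (simp add: M.prob_space)
  have sb: "sum b P = 1" using ib(2)[of "\<lambda>_. 1"] by (simp add: N.prob_space)
  have ne: "P \<noteq> {}" using sa by auto
  obtain p where p: "\<And>i j. 0 \<le> p i j" "\<And>i. i \<in> P \<Longrightarrow> (\<Sum>j\<in>P. p i j) = a i"
    "\<And>j. j \<in> P \<Longrightarrow> (\<Sum>i\<in>P. p i j) = b j" "(\<Sum>i\<in>P. \<Sum>j\<in>P. p i j * d i j) \<le> C + 2 * e"
  proof (rule finite_kantorovich[of P a b d "C + 2 * e"])
    fix f :: "'a \<Rightarrow> real" assume f: "\<And>i j. i \<in> P \<Longrightarrow> j \<in> P \<Longrightarrow> f i - f j \<le> d i j"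
    \<comment> \<open>McShane extension of \<open>f\<close> from the net to the whole space; as a
      finite minimum it is measurable.\<close>
    define F where "F x = (MIN i\<in>P. f i + d x i)" for x
    have F_le: "F x \<le> f i + d x i" if "i \<in> P" for x i
      unfolding F_def using P that by (intro Min_le) auto
    have F_ge: "y \<le> F x" if "\<And>i. i \<in> P \<Longrightarrow> y \<le> f i + d x i" for x y
      unfolding F_def using P ne that by (intro Min.boundedI) auto
    have lip: "F x - F y \<le> d x y" if "x \<in> space M" "y \<in> space M" for x y
    proof -
      have "F x - d x y \<le> F y"
      proof (rule F_ge)
        fix i assume "i \<in> P"
        then show "F x - d x y \<le> f i + d y i" using F_le[of i x] tri[of x y i] that P by force
      qed
      then show ?thesis by simp
    qed
    have Fm[measurable]: "F \<in> borel_measurable M"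
      unfolding F_def using P meas by (intro borel_measurable_Min) auto
    have Fp: "F i = f i" if "i \<in> P" for i
      using F_le[OF that, of i] F_ge[of "f i" i] f[of i] that refl[of i] sym by (force simp: algebra_simps)
    have close: "\<bar>F x - f (r x)\<bar> \<le> e" if "x \<in> space M" for x
    proof -
      have "r x \<in> space M" using r that P by auto
      then show ?thesis
        using lip[of x "r x"] lip[of "r x" x] r[of x] that Fp[of "r x"] sym[of x "r x"] by force
    qed
    have iF: "integrable M F"
    proof (rule Bochner_Integration.integrable_bound)
      show "integrable M (\<lambda>x. \<bar>f (r x)\<bar> + e)" using ia(1)[of "\<lambda>x. \<bar>f x\<bar>"] by simp
      show "AE x in M. norm (F x) \<le> norm (\<bar>f (r x)\<bar> + e)" 
        using close e by (intro AE_I2) force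
    qed simp
    have iF': "integrable N F"
    proof (rule Bochner_Integration.integrable_bound)
      show "integrable N (\<lambda>x. \<bar>f (r x)\<bar> + e)" using ib(1)[of "\<lambda>x. \<bar>f x\<bar>"] by simp
      show "AE x in N. norm (F x) \<le> norm (\<bar>f (r x)\<bar> + e)" 
        using close e spN by (intro AE_I2) force
    qed simp
    have "(\<integral>x. f (r x) - e \<partial>M) \<le> (\<integral>x. F x \<partial>M)"
      using ia(1) iF close by (intro integral_mono) (auto simp: abs_le_iff algebra_simps)
    moreover have "(\<integral>x. F x \<partial>N) \<le> (\<integral>x. f (r x) + e \<partial>N)"
      using ib(1) iF' close spN by (intro integral_mono) (auto simp: abs_le_iff algebra_simps)
    moreover have "(\<integral>x. F x \<partial>M) - (\<integral>x. F x \<partial>N) \<le> C" using lip by (intro dual) simp_all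
    ultimately show "(\<Sum>i\<in>P. f i * a i) - (\<Sum>i\<in>P. f i * b i) \<le> C + 2 * e"
      using ia ib by (simp add: M.prob_space N.prob_space)
  next
    show "d i k \<le> d i j + d j k" if "i \<in> P" "j \<in> P" "k \<in> P" for i j k
      using tri that P by auto
  qed (use P sa sb refl in \<open>auto simp: a_def b_def\<close>)
  obtain \<pi> where \<pi>: "\<pi> \<in> couplings M N"
    "\<And>u :: 'a \<Rightarrow> 'a \<Rightarrow> ennreal. (\<integral>\<^sup>+ z. u (r (fst z)) (r (snd z)) \<partial>\<pi>) = (\<Sum>i\<in>P. \<Sum>j\<in>P. u i j * ennreal (p i j))"
    using ex_coupling_of_quantized[OF PM PN rM rN P(1), of p] r(1) p spN unfolding a_def b_def by blast
  have sp: "space \<pi> = space M \<times> space M"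
    using \<pi>(1) spN sets_eq_imp_space_eq[of \<pi> "M \<Otimes>\<^sub>M N"] by (simp add: couplings_def space_pair_measure)
  have "wasserstein1 d M N \<le> (\<integral>\<^sup>+ z. ennreal (d (fst z) (snd z)) \<partial>\<pi>)"
    unfolding wasserstein1_def using \<pi>(1) by (intro INF_lower)
  also have "\<dots> \<le> (\<integral>\<^sup>+ z. ennreal (d (r (fst z)) (r (snd z)) + 2 * e) \<partial>\<pi>)"
  proof (intro nn_integral_mono ennreal_leI)
    fix z assume "z \<in> space \<pi>"
    then have z: "fst z \<in> space M" "snd z \<in> space M" "r (fst z) \<in> space M" "r (snd z) \<in> space M"
      using sp r P by auto
    have "d (fst z) (snd z) \<le> d (fst z) (r (fst z)) + (d (r (fst z)) (r (snd z)) + d (r (snd z)) (snd z))"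
      using tri[of "fst z" "r (fst z)" "snd z"] tri[of "r (fst z)" "r (snd z)" "snd z"] z by linarith
    then show "d (fst z) (snd z) \<le> d (r (fst z)) (r (snd z)) + 2 * e"
      using r(2)[of "fst z"] r(2)[of "snd z"] z sym[of "snd z"] by simp
  qed
  also have "\<dots> = (\<Sum>i\<in>P. \<Sum>j\<in>P. ennreal (d i j + 2 * e) * ennreal (p i j))" by (rule \<pi>(2))
  also have "\<dots> = ennreal (\<Sum>i\<in>P. \<Sum>j\<in>P. (d i j + 2 * e) * p i j)"
    using p(1) nonneg e by (simp add: sum_ennreal sum_nonneg del: ennreal_plus flip: ennreal_mult)
  also have "\<dots> \<le> ennreal (C + 4 * e)"
  proof (rule ennreal_leI)
    have "(\<Sum>i\<in>P. \<Sum>j\<in>P. (d i j + 2 * e) * p i j) = (\<Sum>i\<in>P. \<Sum>j\<in>P. p i j * d i j) + 2 * e * (\<Sum>i\<in>P. \<Sum>j\<in>P. p i j)"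
      by (simp add: sum.distrib sum_distrib_left algebra_simps)
    then show "(\<Sum>i\<in>P. \<Sum>j\<in>P. (d i j + 2 * e) * p i j) \<le> C + 4 * e"
      using p(2,4) sa by simp
  qed
  also have "\<dots> = ennreal C + ennreal \<epsilon>" using \<open>C \<ge> 0\<close> \<epsilon> by (simp add: e_def)
  finally show "wasserstein1 d M N \<le> ennreal C + ennreal \<epsilon>" .
qed

section \<open>The metric of the torus\<close>

text \<open>The difference \<open>f\<close> has second derivative 2 (1 - cos t)(1 + 4 cos t), which
  changes sign at arccos (-1/4). Up to there \<open>f\<close> is convex, with value and slope zero
  at the origin; beyond, it is concave and nonnegative at both ends, at pi because pi^2 is at most
  12.\<close>

lemma square_le_one_minus_cos:
  fixes t :: real
  assumes "\<bar>t\<bar> \<le> pi"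
  shows "t\<^sup>2 \<le> 2 * (1 - cos t) + 2 * (1 - cos t)\<^sup>2"
proof -
  define f where "f t = 2 * (1 - cos t) + 2 * (1 - cos t)\<^sup>2 - t\<^sup>2" for t :: real
  define g where "g t = 2 * sin t + 4 * (1 - cos t) * sin t - 2 * t" for t :: real
  define h where "h t = 2 * (1 - cos t) * (1 + 4 * cos t)" for t :: real
  define \<tau> where "\<tau> = arccos (- 1 / 4)"
  have \<tau>: "0 \<le> \<tau>" "\<tau> \<le> pi" "cos \<tau> = - 1 / 4"
    by (auto simp: \<tau>_def arccos_lbound arccos_ubound)
  have f': "(f has_real_derivative g t) (at t)" for t
    unfolding f_def g_def by (auto intro!: derivative_eq_intros simp: algebra_simps power2_eq_square)
  have g': "(g has_real_derivative h t) (at t)" for t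
  proof -
    have "(g has_real_derivative 2 * cos t + 4 * ((sin t)\<^sup>2 + (1 - cos t) * cos t) - 2) (at t)"
      unfolding g_def by (auto intro!: derivative_eq_intros simp: algebra_simps power2_eq_square)
    moreover have "2 * cos t + 4 * ((sin t)\<^sup>2 + (1 - cos t) * cos t) - 2 = h t"
      unfolding sin_squared_eq h_def by (simp add: algebra_simps power2_eq_square)
    ultimately show ?thesis by simp
  qed
  have low: "0 \<le> f t" if t: "0 \<le> t" "t \<le> \<tau>" for t
  proof -
    have g0: "0 \<le> g x" if "0 \<le> x" "x \<le> \<tau>" for x
    proof -
      have "g 0 \<le> g x"
      proof (rule DERIV_nonneg_imp_nondecreasing[OF that(1)])
        fix y assume "0 \<le> y" "y \<le> x"
        then have "cos \<tau> \<le> cos y" using that \<tau> by (intro cos_monotone_0_pi_le) auto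
        then have "0 \<le> h y" unfolding h_def \<tau> by (intro mult_nonneg_nonneg) auto
        then show "\<exists>z. (g has_real_derivative z) (at y) \<and> 0 \<le> z" using g' by blast
      qed
      then show ?thesis by (simp add: g_def)
    qed
    have "f 0 \<le> f t"
      by (rule DERIV_nonneg_imp_nondecreasing[OF t(1)]) (use f' g0 t in \<open>meson order_trans\<close>)
    then show ?thesis by (simp add: f_def)
  qed
  have cvx: "convex_on {\<tau>..pi} (\<lambda>x. - f x)"
  proof (rule f''_ge0_imp_convex)
    show "((\<lambda>x. - f x) has_real_derivative - g x) (at x)" for x
      by (intro DERIV_minus f')
    show "((\<lambda>x. - g x) has_real_derivative - h x) (at x)" for x
      by (intro DERIV_minus g')
    show "0 \<le> - h x" if "x \<in> {\<tau>..pi}" for x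
    proof -
      have "cos x \<le> cos \<tau>" using that \<tau> by (intro cos_monotone_0_pi_le) auto
      then have "2 * (1 - cos x) * (1 + 4 * cos x) \<le> 0" unfolding \<tau> by (intro mult_nonneg_nonpos) auto
      then show ?thesis by (simp add: h_def)
    qed
  qed simp
  have "pi\<^sup>2 \<le> 12"
  proof -
    have "pi\<^sup>2 \<le> (17 / 5)\<^sup>2" using pi_approx by (intro power_mono) auto
    then show ?thesis by (simp add: power2_eq_square)
  qed
  then have fpi: "0 \<le> f pi" by (simp add: f_def)
  have high: "0 \<le> f t" if t: "\<tau> \<le> t" "t \<le> pi" for t
  proof -
    have ne: "\<tau> \<noteq> pi" using \<tau>(3) by auto
    then have lt: "\<tau> < pi" using \<tau> by simp
    define u where "u = (t - \<tau>) / (pi - \<tau>)"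
    have u: "0 \<le> u" "u \<le> 1" using t lt by (simp_all add: u_def)
    have "u * (pi - \<tau>) = t - \<tau>" using lt by (simp add: u_def)
    then have "(1 - u) *\<^sub>R \<tau> + u *\<^sub>R pi = t" by (simp add: algebra_simps)
    then have "- f t \<le> (1 - u) * (- f \<tau>) + u * (- f pi)"
      using convex_onD_Icc[OF cvx \<tau>(2) u] by simp
    moreover have "0 \<le> (1 - u) * f \<tau>" "0 \<le> u * f pi"
      using u low[of \<tau>] fpi \<tau> by auto
    ultimately show ?thesis by simp
  qed
  have "0 \<le> f \<bar>t\<bar>" using low[of "\<bar>t\<bar>"] high[of "\<bar>t\<bar>"] assms by linarith
  then show ?thesis by (simp add: f_def)
qed

section \<open>Arc length on the circle through the argument of a quotient\<close>

lemma abs_Arg_cis_le: "\<bar>Arg (cis x)\<bar> \<le> \<bar>x\<bar>"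
proof (cases "x \<in> {-pi<..pi}")
  case False
  then show ?thesis using mpi_less_Arg[of "cis x"] Arg_le_pi[of "cis x"] by auto
qed (simp add: Arg_cis)

lemma unit_cis_Arg: "norm z = 1 \<Longrightarrow> cis (Arg z) = z"
  by (subst cis_Arg) (auto simp: sgn_eq)

text \<open>The quotient makes rotation invariance visible. The difference of the two angles lies
  within 2 pi of 0, so at most one full turn has to be removed; the absolute value hides that
  \<open>Arg\<close> prefers pi to -pi.\<close>

lemma arc_dist_eq:
  assumes "norm z = 1" "norm w = 1"
  shows "arc_dist z w = \<bar>Arg (z * cnj w)\<bar>"
proof -
  define t where "t = Arg z - Arg w"
  have t: "z * cnj w = cis t"
    using unit_cis_Arg[OF assms(1)] unit_cis_Arg[OF assms(2)]
    by (metis cis_cnj cis_mult t_def diff_conv_add_uminus)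
  have bd: "- 2 * pi < t" "t < 2 * pi"
    using mpi_less_Arg[of z] Arg_le_pi[of z] mpi_less_Arg[of w] Arg_le_pi[of w] by (auto simp: t_def)
  have per: "cis (t - 2 * pi) = cis t" "cis (t + 2 * pi) = cis t"
    by (simp_all add: cis.ctr complex_eq_iff cos_diff sin_diff cos_add sin_add)
  consider "t \<le> - pi" | "t \<in> {-pi<..pi}" | "pi < t" by fastforce
  then show ?thesis
  proof cases
    case 1
    then have "Arg (cis t) = t + 2 * pi" using Arg_cis[of "t + 2 * pi"] bd per by auto
    then show ?thesis using 1 bd by (simp add: arc_dist_def t flip: t_def)
  next
    case 2
    then have "Arg (cis t) = t" by (rule Arg_cis)
    then show ?thesis using 2 bd by (auto simp: arc_dist_def t simp flip: t_def)
  next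
    case 3
    then have "Arg (cis t) = t - 2 * pi" using Arg_cis[of "t - 2 * pi"] bd per by auto
    then show ?thesis using 3 bd by (simp add: arc_dist_def t flip: t_def)
  qed
qed

lemma arc_dist_sym: "arc_dist z w = arc_dist w z"
  by (simp add: arc_dist_def abs_minus_commute)

lemma arc_dist_refl [simp]: "arc_dist z z = 0"
  by (simp add: arc_dist_def)

text \<open>The arguments of the two quotients add up to some angle of their product, and
  \<open>Arg\<close> is the angle of least modulus.\<close>

lemma arc_dist_triangle:
  assumes "norm x = 1" "norm y = 1" "norm z = 1"
  shows "arc_dist x z \<le> arc_dist x y + arc_dist y z"
proof -
  have "y * cnj y = 1" using assms by (simp add: complex_norm_square[symmetric])
  have "x * cnj z = x * cnj z * (y * cnj y)" using \<open>y * cnj y = 1\<close> by simp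
  also have "\<dots> = (x * cnj y) * (y * cnj z)" by (simp only: mult_ac)
  also have "\<dots> = cis (Arg (x * cnj y)) * cis (Arg (y * cnj z))"
    using assms by (simp add: unit_cis_Arg norm_mult)
  also have "\<dots> = cis (Arg (x * cnj y) + Arg (y * cnj z))" by (rule cis_mult)
  finally have eq: "x * cnj z = cis (Arg (x * cnj y) + Arg (y * cnj z))" .
  have "\<bar>Arg (x * cnj z)\<bar> \<le> \<bar>Arg (x * cnj y) + Arg (y * cnj z)\<bar>"
    unfolding eq by (rule abs_Arg_cis_le)
  then show ?thesis using assms by (simp add: arc_dist_eq)
qed

lemma Arg_square_le:
  assumes "norm z = 1"
  shows "(Arg z)\<^sup>2 \<le> 2 * (1 - Re z) + 2 * (1 - Re z)\<^sup>2"
proof -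
  have "cos (Arg z) = Re z" using unit_cis_Arg[OF assms] by (metis cis.sel(1))
  then show ?thesis
    using square_le_one_minus_cos[of "Arg z"] mpi_less_Arg[of z] Arg_le_pi[of z] by (simp add: abs_le_iff)
qed

text \<open>On the circle 1 - Re u is at most 2, so the quadratic term of
  \<open>Arg_square_le\<close> is absorbed at the price of a factor 3. The bound carries continuity
  and nets over from the Euclidean metric; its constant does not enter the final estimate.\<close>

lemma arc_dist_le_dist:
  assumes "norm z = 1" "norm w = 1"
  shows "arc_dist z w \<le> sqrt 3 * dist z w"
proof -
  define u where "u = z * cnj w"
  have u: "norm u = 1" using assms by (simp add: u_def norm_mult)
  have "cnj w * w = 1" using assms by (simp add: complex_norm_square[symmetric] mult.commute)
  then have "z - w = w * (u - 1)" by (simp add: u_def algebra_simps)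
  then have "dist z w = norm (u - 1)" using assms by (simp add: dist_norm norm_mult)
  moreover have "(norm (u - 1))\<^sup>2 = 2 * (1 - Re u)"
    using u cmod_power2[of u] by (simp add: cmod_power2 power2_diff)
  ultimately have d: "(dist z w)\<^sup>2 = 2 * (1 - Re u)" by simp
  have "0 \<le> 1 - Re u" "1 - Re u \<le> 2" using abs_Re_le_cmod[of u] u by auto
  then have "(1 - Re u)\<^sup>2 \<le> 2 * (1 - Re u)" using mult_right_mono[of "1 - Re u" 2 "1 - Re u"] by (simp add: power2_eq_square)
  then have "(Arg u)\<^sup>2 \<le> 3 * (dist z w)\<^sup>2" using Arg_square_le[OF u] d by simp
  then have "sqrt ((Arg u)\<^sup>2) \<le> sqrt (3 * (dist z w)\<^sup>2)" by (rule real_sqrt_le_mono)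
  then show ?thesis using assms by (simp add: arc_dist_eq u_def real_sqrt_mult)
qed

section \<open>Metric and topology of the torus\<close>

lemma torusI: "(\<And>j. norm (z $ j) = 1) \<Longrightarrow> z \<in> torus"
  by (simp add: torus_def)

lemma torus_norm: "z \<in> torus \<Longrightarrow> norm (z $ j) = 1"
  by (simp add: torus_def)

lemma torus_dist_L2_set: "torus_dist z w = L2_set (\<lambda>j. arc_dist (z $ j) (w $ j)) UNIV"
  by (simp add: torus_dist_def L2_set_def)

lemma torus_dist_nonneg: "0 \<le> torus_dist z w"
  by (simp add: torus_dist_L2_set L2_set_nonneg)

lemma torus_dist_refl [simp]: "torus_dist z z = 0"
  by (simp add: torus_dist_def)

lemma torus_dist_sym: "torus_dist z w = torus_dist w z"
  by (simp add: torus_dist_def arc_dist_sym)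

lemma arc_dist_nonneg: "norm z = 1 \<Longrightarrow> norm w = 1 \<Longrightarrow> 0 \<le> arc_dist z w"
  by (simp add: arc_dist_eq)

lemma torus_dist_triangle:
  assumes "x \<in> torus" "y \<in> torus" "z \<in> torus"
  shows "torus_dist x z \<le> torus_dist x y + torus_dist y z"
proof -
  have "torus_dist x z \<le> L2_set (\<lambda>j. arc_dist (x $ j) (y $ j) + arc_dist (y $ j) (z $ j)) UNIV"
    unfolding torus_dist_L2_set using assms
    by (intro L2_set_mono arc_dist_triangle arc_dist_nonneg) (simp_all add: torus_norm)
  also have "\<dots> \<le> torus_dist x y + torus_dist y z"
    unfolding torus_dist_L2_set by (rule L2_set_triangle_ineq)
  finally show ?thesis .
qed

lemma torus_dist_le_dist:
  assumes "x \<in> torus" "y \<in> torus"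
  shows "torus_dist x y \<le> sqrt 3 * dist x y"
proof -
  have "torus_dist x y \<le> L2_set (\<lambda>j. sqrt 3 * dist (x $ j) (y $ j)) UNIV"
    unfolding torus_dist_L2_set using assms
    by (intro L2_set_mono arc_dist_le_dist arc_dist_nonneg) (simp_all add: torus_norm)
  also have "\<dots> = sqrt 3 * dist x y"
    by (simp add: dist_vec_def L2_set_right_distrib)
  finally show ?thesis .
qed

lemma continuous_on_torus_lipschitz:
  fixes F :: "complex ^ 'n \<Rightarrow> real"
  assumes "\<And>x y. x \<in> torus \<Longrightarrow> y \<in> torus \<Longrightarrow> F x - F y \<le> torus_dist x y"
  shows "continuous_on torus F"
proof (rule lipschitz_on_continuous_on, rule lipschitz_onI)
  fix x y :: "complex ^ 'n" assume "x \<in> torus" "y \<in> torus"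
  then show "dist (F x) (F y) \<le> sqrt 3 * dist x y"
    using assms[of x y] assms[of y x] torus_dist_le_dist[of x y] torus_dist_sym[of y x]
    by (simp add: dist_real_def)
qed simp

lemma space_torus_borel [simp]: "space torus_borel = torus"
  by (simp add: torus_borel_def space_restrict_space)

lemma borel_measurable_torus:
  fixes F :: "complex ^ 'n \<Rightarrow> 'b::topological_space"
  shows "continuous_on torus F \<Longrightarrow> F \<in> borel_measurable torus_borel"
  unfolding torus_borel_def by (rule borel_measurable_continuous_on_restrict)

lemma closed_torus: "closed (torus :: (complex ^ 'n) set)"
proof -
  have "torus = {z :: complex ^ 'n. \<forall>j. norm (z $ j) = 1}" by (simp add: torus_def)
  moreover have "closed {z :: complex ^ 'n. \<forall>j. norm (z $ j) = 1}"
    by (intro closed_Collect_all closed_Collect_eq continuous_intros)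
  ultimately show ?thesis by simp
qed

lemma compact_torus: "compact (torus :: (complex ^ 'n) set)"
proof -
  have "bounded (torus :: (complex ^ 'n) set)"
  proof (rule boundedI)
    fix z :: "complex ^ 'n" assume "z \<in> torus"
    have "norm z \<le> (\<Sum>i\<in>UNIV. norm (z $ i))"
      unfolding norm_vec_def by (rule L2_set_le_sum) simp
    then show "norm z \<le> real CARD('n)" using \<open>z \<in> torus\<close> by (simp add: torus_norm)
  qed
  then show ?thesis by (simp add: compact_eq_bounded_closed closed_torus)
qed

lemma torus_net:
  assumes "0 < e"
  shows "\<exists>P :: (complex ^ 'n) set. finite P \<and> P \<subseteq> torus \<and> (\<forall>x\<in>torus. \<exists>p\<in>P. torus_dist x p \<le> e)"
proof -
  have cov: "(torus :: (complex ^ 'n) set) \<subseteq> (\<Union>x\<in>torus. ball x (e / sqrt 3))"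
  proof
    fix x :: "complex ^ 'n" assume "x \<in> torus"
    moreover have "x \<in> ball x (e / sqrt 3)" using assms by simp
    ultimately show "x \<in> (\<Union>x\<in>torus. ball x (e / sqrt 3))" by (rule UN_I)
  qed
  obtain P :: "(complex ^ 'n) set" where P: "P \<subseteq> torus" "finite P" "torus \<subseteq> (\<Union>x\<in>P. ball x (e / sqrt 3))"
    by (rule compactE_image[OF compact_torus open_ball cov])
  have "\<exists>p\<in>P. torus_dist x p \<le> e" if xt: "x \<in> torus" for x
  proof -
    obtain p where p: "p \<in> P" "dist p x < e / sqrt 3"
      using subsetD[OF P(3) xt] by (auto simp only: UN_iff mem_ball)
    have "torus_dist x p \<le> sqrt 3 * dist x p"
      using xt subsetD[OF P(1) p(1)] by (rule torus_dist_le_dist)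
    also have "\<dots> \<le> sqrt 3 * (e / sqrt 3)"
      using p(2) by (intro mult_left_mono) (simp_all only: dist_commute less_imp_le real_sqrt_ge_zero zero_le_numeral)
    also have "\<dots> = e" by simp
    finally show ?thesis using p(1) by (rule bexI)
  qed
  with P show ?thesis by blast
qed

section \<open>Invariant measures and characters\<close>

text \<open>The half-open interval allows a translated period to be cut into disjoint
  pieces.\<close>

definition circle_measure :: "complex measure" where
  "circle_measure =
    distr (uniform_measure lborel {-pi..<pi}) (restrict_space borel (sphere 0 1)) cis"

lemma space_circle_measure [simp]: "space circle_measure = sphere 0 1"
  by (simp add: circle_measure_def space_restrict_space)

lemma sets_circle_measure [measurable_cong]:
  "sets circle_measure = sets (restrict_space borel (sphere 0 1))"
  by (simp add: circle_measure_def)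

lemma cis_measurable_circle [measurable]:
  "cis \<in> measurable borel (restrict_space borel (sphere 0 1))"
  by (intro measurable_restrict_space2 borel_measurable_continuous_onI continuous_intros) auto

lemma prob_space_circle_measure: "prob_space circle_measure"
proof -
  have "prob_space (uniform_measure lborel {-pi..<pi})"
    by (rule prob_space_uniform_measure) auto
  then show ?thesis
    unfolding circle_measure_def by (rule prob_space.prob_space_distr) simp
qed

lemma emeasure_circle_measure:
  assumes "A \<in> sets circle_measure"
  shows "emeasure circle_measure A =
    (\<integral>\<^sup>+ t. indicator A (cis t) * indicator {-pi..<pi} t \<partial>lborel) / ennreal (2 * pi)"
proof -
  have [measurable]: "A \<in> sets (restrict_space borel (sphere 0 1))"
    using assms by (simp add: sets_circle_measure)
  have "emeasure circle_measure A = (\<integral>\<^sup>+ z. indicator A z \<partial>circle_measure)"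
    using assms by simp
  also have "\<dots> = (\<integral>\<^sup>+ t. indicator A (cis t) \<partial>uniform_measure lborel {-pi..<pi})"
    unfolding circle_measure_def by (rule nn_integral_distr) simp_all
  also have "\<dots> = (\<integral>\<^sup>+ t. indicator A (cis t) * indicator {-pi..<pi} t \<partial>lborel) / emeasure lborel {-pi..<pi}"
    by (rule nn_integral_uniform_measure) simp_all
  finally show ?thesis by simp
qed

text \<open>The piece of the shifted period that sticks out beyond \<open>a + p\<close> is moved
  back by one period and fills the gap on the left.\<close>

lemma nn_integral_periodic_shift:
  fixes f :: "real \<Rightarrow> ennreal"
  assumes [measurable]: "f \<in> borel_measurable borel" and per: "\<And>t. f (t + p) = f t"
    and s: "0 \<le> s" "s \<le> p"
  shows "(\<integral>\<^sup>+ t. f t * indicator {a + s..<a + s + p} t \<partial>lborel) = (\<integral>\<^sup>+ t. f t * indicator {a..<a + p} t \<partial>lborel)"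
proof -
  have "(\<integral>\<^sup>+ t. f t * indicator {a + s..<a + s + p} t \<partial>lborel) =
      (\<integral>\<^sup>+ t. f t * indicator {a + s..<a + p} t + f t * indicator {a + p..<a + s + p} t \<partial>lborel)"
    using s by (intro nn_integral_cong) (auto simp: indicator_def)
  also have "\<dots> = (\<integral>\<^sup>+ t. f t * indicator {a + s..<a + p} t \<partial>lborel) +
      (\<integral>\<^sup>+ t. f t * indicator {a + p..<a + s + p} t \<partial>lborel)"
    by (rule nn_integral_add) simp_all
  also have "(\<integral>\<^sup>+ t. f t * indicator {a + p..<a + s + p} t \<partial>lborel) =
      (\<integral>\<^sup>+ t. f (p + t) * indicator {a + p..<a + s + p} (p + t) \<partial>lborel)"
    using nn_integral_real_affine[of "\<lambda>t. f t * indicator {a + p..<a + s + p} t" 1 p] by simp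
  also have "\<dots> = (\<integral>\<^sup>+ t. f t * indicator {a..<a + s} t \<partial>lborel)"
    using per by (intro nn_integral_cong) (auto simp: indicator_def add.commute)
  also have "(\<integral>\<^sup>+ t. f t * indicator {a + s..<a + p} t \<partial>lborel) + (\<integral>\<^sup>+ t. f t * indicator {a..<a + s} t \<partial>lborel) =
      (\<integral>\<^sup>+ t. f t * indicator {a + s..<a + p} t + f t * indicator {a..<a + s} t \<partial>lborel)"
    by (rule nn_integral_add[symmetric]) simp_all
  also have "\<dots> = (\<integral>\<^sup>+ t. f t * indicator {a..<a + p} t \<partial>lborel)"
    using s by (intro nn_integral_cong) (auto simp: indicator_def)
  finally show ?thesis .
qed

lemma circle_mult_measurable [measurable]:
  assumes "norm a = 1"
  shows "(\<lambda>w. a * w) \<in> measurable circle_measure circle_measure"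
proof -
  have "(\<lambda>w. a * w) \<in> measurable (restrict_space borel (sphere 0 1)) (restrict_space borel (sphere 0 1))"
    using assms by (intro measurable_restrict_space3) (auto simp: norm_mult)
  then show ?thesis by (simp cong: measurable_cong_sets add: sets_circle_measure)
qed

lemma distr_circle_rotation:
  assumes a: "norm a = 1"
  shows "distr circle_measure circle_measure (\<lambda>w. a * w) = circle_measure"
proof (rule measure_eqI)
  fix A assume "A \<in> sets (distr circle_measure circle_measure (\<lambda>w. a * w))"
  then have A: "A \<in> sets circle_measure" by simp
  then have [measurable]: "A \<in> sets (restrict_space borel (sphere 0 1))" by (simp add: sets_circle_measure)
  \<comment> \<open>\<open>Arg2pi\<close> rather than \<open>Arg\<close>, because the shift has to
    lie between 0 and one period.\<close>
  define s where "s = Arg2pi a"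
  have s: "0 \<le> s" "s \<le> 2 * pi" using Arg2pi_ge_0[of a] Arg2pi_lt_2pi[of a] by (simp_all add: s_def)
  have as: "a = cis s" using a complex_norm_eq_1_exp[of a] by (simp add: s_def cis_conv_exp)
  define f where "f t = (indicator A (cis t) :: ennreal)" for t
  have fm[measurable]: "f \<in> borel_measurable borel" unfolding f_def by measurable
  have per: "f (t + 2 * pi) = f t" for t by (simp add: f_def cis.ctr)
  have "emeasure (distr circle_measure circle_measure (\<lambda>w. a * w)) A =
      emeasure circle_measure ((\<lambda>w. a * w) -` A \<inter> space circle_measure)"
    using A a by (intro emeasure_distr) auto
  also have "\<dots> = (\<integral>\<^sup>+ t. f (s + t) * indicator {-pi..<pi} t \<partial>lborel) / ennreal (2 * pi)"
  proof -
    have "(\<lambda>w. a * w) -` A \<inter> space circle_measure \<in> sets circle_measure"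
      using A circle_mult_measurable[OF a] by (rule measurable_sets[rotated])
    then show ?thesis
      by (subst emeasure_circle_measure)
        (auto simp: f_def as indicator_def cis_mult intro!: arg_cong2[where f = divide] nn_integral_cong)
  qed
  also have "(\<integral>\<^sup>+ t. f (s + t) * indicator {-pi..<pi} t \<partial>lborel) =
      (\<integral>\<^sup>+ t. f (s + t) * indicator {-pi + s..<-pi + s + 2 * pi} (s + t) \<partial>lborel)"
    by (intro nn_integral_cong) (auto simp: indicator_def)
  also have "\<dots> = (\<integral>\<^sup>+ t. f t * indicator {-pi + s..<-pi + s + 2 * pi} t \<partial>lborel)"
    using nn_integral_real_affine[of "\<lambda>t. f t * indicator {-pi + s..<-pi + s + 2 * pi} t" 1 s] by simp
  also have "\<dots> = (\<integral>\<^sup>+ t. f t * indicator {-pi..<-pi + 2 * pi} t \<partial>lborel)"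
    by (rule nn_integral_periodic_shift) (use per s in auto)
  also have "\<dots> / ennreal (2 * pi) = emeasure circle_measure A"
    using A by (simp add: emeasure_circle_measure f_def)
  finally show "emeasure (distr circle_measure circle_measure (\<lambda>w. a * w)) A = emeasure circle_measure A" .
qed simp

section \<open>Haar measure of the full torus\<close>

text \<open>\<open>PiM\<close> lives on functions, so the product is transported to vectors by
  \<open>vec_lambda\<close>.\<close>

definition torus_measure :: "(complex ^ 'n) measure" where
  "torus_measure = distr (PiM UNIV (\<lambda>_::'n. circle_measure)) torus_borel vec_lambda"

lemma space_torus_measure [simp]: "space torus_measure = torus"
  by (simp add: torus_measure_def)

lemma sets_torus_measure [simp]: "sets torus_measure = sets torus_borel"
  by (simp add: torus_measure_def)

lemma vec_lambda_measurable_torus: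
  "vec_lambda \<in> measurable (PiM UNIV (\<lambda>_::'n::finite. circle_measure)) torus_borel"
  unfolding torus_borel_def
proof (rule measurable_restrict_space2)
  show "vec_lambda \<in> space (PiM UNIV (\<lambda>_::'n. circle_measure)) \<rightarrow> torus"
    by (auto simp: space_PiM PiE_iff torus_def)
  have id: "(\<lambda>z. z) \<in> borel_measurable circle_measure"
    by (simp cong: measurable_cong_sets add: sets_circle_measure measurable_restrict_space1)
  have "(\<lambda>w. w j) \<in> borel_measurable (PiM UNIV (\<lambda>_::'n. circle_measure))" for j
  proof -
    have "(\<lambda>w. w j) \<in> measurable (PiM UNIV (\<lambda>_::'n. circle_measure)) circle_measure"
      by (rule measurable_component_singleton) simp
    from measurable_compose[OF this id] show ?thesis .
  qed
  then have "(\<lambda>w. vec_lambda w \<bullet> axis j b) \<in> borel_measurable (PiM UNIV (\<lambda>_::'n. circle_measure))" for j b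
    by (simp add: inner_axis)
  then show "vec_lambda \<in> borel_measurable (PiM UNIV (\<lambda>_::'n. circle_measure))"
    by (subst borel_measurable_euclidean_space) (auto simp: Basis_vec_def)
qed

interpretation circle: prob_space circle_measure
  by (rule prob_space_circle_measure)

interpretation circles: product_sigma_finite "\<lambda>_. circle_measure"
  by unfold_locales

lemma prob_space_torus_measure: "prob_space torus_measure"
  unfolding torus_measure_def
  by (intro prob_space.prob_space_distr prob_space_PiM prob_space_circle_measure vec_lambda_measurable_torus)

lemma torus_mult: "a \<in> torus \<Longrightarrow> z \<in> torus \<Longrightarrow> a * z \<in> torus"
  by (simp add: torus_def norm_mult)

lemma torus_mult_measurable:
  assumes "a \<in> torus"
  shows "(\<lambda>z. a * z) \<in> measurable torus_borel (torus_borel :: (complex ^ 'n) measure)"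
  unfolding torus_borel_def
proof (rule measurable_restrict_space3)
  show "(\<lambda>z. a * z) \<in> borel_measurable (borel :: (complex ^ 'n) measure)"
    by (intro borel_measurable_continuous_onI) (auto simp: continuous_on_vec_lambda times_vec_def intro!: continuous_intros)
qed (use assms torus_mult in auto)

text \<open>A product measure is determined by its values on boxes, where a rotation acts factor by
  factor.\<close>

lemma distr_torus_rotation:
  fixes a :: "complex ^ 'n"
  assumes a: "a \<in> torus"
  shows "distr torus_measure torus_borel (\<lambda>z. a * z) = torus_measure"
proof -
  let ?P = "PiM UNIV (\<lambda>_::'n. circle_measure)"
  let ?r = "\<lambda>w j. a $ j * w j"
  have aj: "norm (a $ j) = 1" for j using a by (simp add: torus_norm)
  have rm: "?r \<in> measurable ?P ?P"
  proof (rule measurable_PiM_single')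
    show "(\<lambda>w. a $ i * w i) \<in> measurable ?P circle_measure" for i
    proof -
      have "(\<lambda>w. w i) \<in> measurable ?P circle_measure"
        by (rule measurable_component_singleton) simp
      from measurable_compose[OF this circle_mult_measurable[OF aj]] show ?thesis .
    qed
  qed (auto simp: space_PiM PiE_iff norm_mult aj)
  have "distr ?P ?P ?r = ?P"
  proof (rule circles.PiM_eqI)
    fix A :: "'n \<Rightarrow> complex set" assume A: "\<And>i. i \<in> UNIV \<Longrightarrow> A i \<in> sets circle_measure"
    have pre: "(\<lambda>w. a $ i * w) -` A i \<inter> sphere 0 1 \<in> sets circle_measure" for i
      using measurable_sets[OF circle_mult_measurable[OF aj] A, of i] by simp
    have "emeasure (distr ?P ?P ?r) (Pi\<^sub>E UNIV A) = emeasure ?P (?r -` Pi\<^sub>E UNIV A \<inter> space ?P)"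
      using A by (intro emeasure_distr rm sets_PiM_I_finite) auto
    also have "?r -` Pi\<^sub>E UNIV A \<inter> space ?P = Pi\<^sub>E UNIV (\<lambda>i. (\<lambda>w. a $ i * w) -` A i \<inter> sphere 0 1)"
      by (auto simp: space_PiM PiE_iff)
    also have "emeasure ?P \<dots> = (\<Prod>i\<in>UNIV. emeasure circle_measure ((\<lambda>w. a $ i * w) -` A i \<inter> sphere 0 1))"
      using pre by (intro circles.emeasure_PiM) auto
    also have "\<dots> = (\<Prod>i\<in>UNIV. emeasure circle_measure (A i))"
    proof (rule prod.cong)
      fix i
      have "emeasure circle_measure (A i) = emeasure (distr circle_measure circle_measure (\<lambda>w. a $ i * w)) (A i)"
        by (simp add: distr_circle_rotation[OF aj])
      also have "\<dots> = emeasure circle_measure ((\<lambda>w. a $ i * w) -` A i \<inter> sphere 0 1)"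
        using A circle_mult_measurable[OF aj] by (subst emeasure_distr) auto
      finally show "emeasure circle_measure ((\<lambda>w. a $ i * w) -` A i \<inter> sphere 0 1) = emeasure circle_measure (A i)" by simp
    qed simp
    finally show "emeasure (distr ?P ?P ?r) (Pi\<^sub>E UNIV A) = (\<Prod>i\<in>UNIV. emeasure circle_measure (A i))" .
  qed auto
  moreover have "distr (distr ?P torus_borel vec_lambda) torus_borel (\<lambda>z. a * z) =
      distr ?P torus_borel ((\<lambda>z. a * z) \<circ> vec_lambda)"
    by (rule distr_distr) (rule torus_mult_measurable[OF a] vec_lambda_measurable_torus)+
  moreover have "distr (distr ?P ?P ?r) torus_borel vec_lambda = distr ?P torus_borel (vec_lambda \<circ> ?r)"
    by (rule distr_distr) (rule rm vec_lambda_measurable_torus)+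
  moreover have "(\<lambda>z. a * z) \<circ> vec_lambda = vec_lambda \<circ> ?r"
    by (auto simp: times_vec_def)
  ultimately show ?thesis by (simp add: torus_measure_def)
qed

lemma integrable_torus:
  fixes f :: "complex ^ 'n \<Rightarrow> 'b::{banach, second_countable_topology}"
  assumes "finite_measure M" and sets: "sets M = sets torus_borel" and f: "continuous_on torus f"
  shows "integrable M f"
proof -
  interpret finite_measure M by fact
  have "bounded (f ` torus)"
    by (intro compact_imp_bounded compact_continuous_image f compact_torus)
  then obtain B where "\<And>z. z \<in> torus \<Longrightarrow> norm (f z) \<le> B" unfolding bounded_iff by blast
  moreover have "space M = torus" using sets_eq_imp_space_eq[OF sets] by simp
  moreover have "f \<in> borel_measurable M"
    using borel_measurable_torus[OF f] by (simp cong: measurable_cong_sets add: sets)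
  ultimately show ?thesis by (intro integrable_const_bound[of _ B]) auto
qed

lemma integrable_circle:
  fixes f :: "complex \<Rightarrow> 'b::{banach, second_countable_topology}"
  assumes f: "continuous_on (sphere 0 1) f"
  shows "integrable circle_measure f"
proof -
  have "bounded (f ` sphere 0 1)"
    by (intro compact_imp_bounded compact_continuous_image f) simp
  then obtain B where "\<And>z. z \<in> sphere 0 1 \<Longrightarrow> norm (f z) \<le> B" unfolding bounded_iff by blast
  moreover have "f \<in> borel_measurable circle_measure"
    using borel_measurable_continuous_on_restrict[OF f] by (simp cong: measurable_cong_sets add: sets_circle_measure)
  ultimately show ?thesis by (intro circle.integrable_const_bound[of _ B]) auto
qed

text \<open>Rotation by a number whose k-th power is -1 preserves the measure and negates the
  integrand, so the integral is its own negative.\<close>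

lemma integral_circle_power_int:
  "(\<integral>u. u powi k \<partial>circle_measure) = (if k = 0 then 1 else 0)"
proof (cases "k = 0")
  case True
  then show ?thesis using circle.prob_space by simp
next
  case False
  define a where "a = cis (pi / of_int k)"
  have a: "norm a = 1" "a powi k = -1" using False by (simp_all add: a_def cis_power_int)
  have cont: "continuous_on (sphere 0 1) (\<lambda>u::complex. u powi k)"
    by (intro continuous_intros) auto
  then have m: "(\<lambda>u. u powi k) \<in> borel_measurable circle_measure"
    by (rule borel_measurable_integrable[OF integrable_circle])
  have "(\<integral>u. u powi k \<partial>circle_measure) = (\<integral>u. u powi k \<partial>distr circle_measure circle_measure (\<lambda>w. a * w))"
    by (simp add: distr_circle_rotation a)
  also have "\<dots> = (\<integral>u. (a * u) powi k \<partial>circle_measure)"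
    using m a by (intro integral_distr) auto
  also have "\<dots> = - (\<integral>u. u powi k \<partial>circle_measure)"
    by (simp add: power_int_mult_distrib a)
  finally show ?thesis using False by simp
qed

lemma integral_torus_rotation:
  fixes f :: "complex ^ 'n \<Rightarrow> 'b::{banach, second_countable_topology}"
  assumes a: "a \<in> torus" and f: "continuous_on torus f"
  shows "(\<integral>z. f (a * z) \<partial>torus_measure) = (\<integral>z. f z \<partial>torus_measure)"
proof -
  have "(\<integral>z. f z \<partial>torus_measure) = (\<integral>z. f z \<partial>distr torus_measure torus_borel (\<lambda>z. a * z))"
    by (simp add: distr_torus_rotation a)
  also have "\<dots> = (\<integral>z. f (a * z) \<partial>torus_measure)"
    using torus_mult_measurable[OF a] borel_measurable_torus[OF f]
    by (intro integral_distr) (simp_all cong: measurable_cong_sets)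
  finally show ?thesis by simp
qed

lemma integral_torus_prod:
  fixes f :: "'n::finite \<Rightarrow> complex \<Rightarrow> real"
  assumes f: "\<And>j. continuous_on (sphere 0 1) (f j)"
  shows "(\<integral>z. (\<Prod>j\<in>UNIV. f j (z $ j)) \<partial>torus_measure) = (\<Prod>j\<in>UNIV. \<integral>u. f j u \<partial>circle_measure)"
proof -
  have cont: "continuous_on torus (\<lambda>z. \<Prod>j\<in>UNIV. f j (z $ j))"
    by (intro continuous_on_prod continuous_on_compose2[OF f] continuous_intros) (auto simp: torus_norm)
  have "(\<integral>z. (\<Prod>j\<in>UNIV. f j (z $ j)) \<partial>torus_measure) =
      (\<integral>w. (\<Prod>j\<in>UNIV. f j (w j)) \<partial>PiM UNIV (\<lambda>_. circle_measure))"
    unfolding torus_measure_def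
    by (subst integral_distr[OF vec_lambda_measurable_torus borel_measurable_torus[OF cont]]) simp
  also have "\<dots> = (\<Prod>j\<in>UNIV. \<integral>u. f j u \<partial>circle_measure)"
    by (rule circles.product_integral_prod) (auto intro: integrable_circle f)
  finally show ?thesis .
qed

section \<open>Characters of the torus and their orthogonality\<close>

text \<open>Frequencies are integer-valued functions rather than real vectors, so that products of
  one-dimensional expansions unfold by \<open>prod_sum_PiE\<close>; \<open>freq_vec\<close>
  translates them into lattice vectors at the end.\<close>

definition torus_char :: "('n \<Rightarrow> int) \<Rightarrow> complex ^ 'n \<Rightarrow> complex" where
  "torus_char m z = (\<Prod>j\<in>UNIV. (z $ j) powi m j)"

lemma torus_nonzero: "z \<in> torus \<Longrightarrow> z $ j \<noteq> 0"
  using torus_norm[of z j] by force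

lemma continuous_on_torus_char [continuous_intros]:
  fixes f :: "'a::topological_space \<Rightarrow> complex ^ 'n"
  assumes "continuous_on S f" "\<And>x. x \<in> S \<Longrightarrow> f x \<in> torus"
  shows "continuous_on S (\<lambda>x. torus_char m (f x))"
  unfolding torus_char_def using assms by (intro continuous_intros) (auto simp: torus_nonzero)

lemma torus_char_mult: "torus_char m (a * z) = torus_char m a * torus_char m z"
  by (simp add: torus_char_def power_int_mult_distrib prod.distrib)

lemma torus_char_add:
  "z \<in> torus \<Longrightarrow> torus_char (\<lambda>j. m j + k j) z = torus_char m z * torus_char k z"
  by (simp add: torus_char_def power_int_add torus_nonzero prod.distrib)

lemma cnj_torus_char: "z \<in> torus \<Longrightarrow> cnj (torus_char m z) = torus_char (\<lambda>j. - m j) z"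
proof -
  assume z: "z \<in> torus"
  have "cnj (z $ j) = inverse (z $ j)" for j
    by (rule inverse_unique[symmetric]) (simp add: complex_norm_square[symmetric] torus_norm[OF z])
  then show ?thesis by (simp add: torus_char_def power_int_minus power_int_inverse)
qed

lemma torus_char_cis: "torus_char m (\<chi> j. cis (\<theta> j)) = cis (\<Sum>j\<in>UNIV. of_int (m j) * \<theta> j)"
proof -
  have "(\<Prod>j\<in>A. cis (of_int (m j) * \<theta> j)) = cis (\<Sum>j\<in>A. of_int (m j) * \<theta> j)" for A
    by (induction A rule: infinite_finite_induct) (simp_all add: cis_mult)
  then show ?thesis by (simp add: torus_char_def cis_power_int)
qed

lemma integral_torus_char:
  fixes m :: "'n::finite \<Rightarrow> int"
  shows "(\<integral>z. torus_char m z \<partial>torus_measure) = (if m = (\<lambda>_. 0) then 1 else 0)"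
proof (cases "m = (\<lambda>_. 0)")
  case True
  interpret prob_space "torus_measure :: (complex ^ 'n) measure" by (rule prob_space_torus_measure)
  show ?thesis using True prob_space by (simp add: torus_char_def)
next
  case False
  then obtain i where i: "m i \<noteq> 0" by auto
  \<comment> \<open>Turning coordinate i alone, by pi / m i, already multiplies the character by
    -1.\<close>
  define a where "a = (\<chi> j. cis (if j = i then pi / of_int (m i) else 0))"
  have "a \<in> torus" by (rule torusI) (simp add: a_def)
  have "(\<Sum>j\<in>UNIV. of_int (m j) * (if j = i then pi / of_int (m i) else 0)) = 
      (\<Sum>j\<in>UNIV. if j = i then pi else 0)"
    using i by (intro sum.cong) auto
  then have "torus_char m a = -1"
    unfolding a_def torus_char_cis by simp
  then have "(\<integral>z. torus_char m z \<partial>torus_measure) = (\<integral>z. - torus_char m z \<partial>torus_measure)"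
    using integral_torus_rotation[OF \<open>a \<in> torus\<close>, of "torus_char m"]
      continuous_on_torus_char[of torus "\<lambda>z. z" m]
    by (simp add: torus_char_mult)
  then show ?thesis using False by simp
qed

section \<open>A trigonometric kernel with small second moment\<close>

text \<open>Parseval on the circle; it turns both the mass and the second moment of the kernel into
  finite sums of squares.\<close>

lemma integral_circle_norm_poly:
  fixes q :: "nat \<Rightarrow> real"
  shows "(\<integral>u. (norm (\<Sum>i\<le>N. of_real (q i) * u ^ i))\<^sup>2 \<partial>circle_measure) = (\<Sum>i\<le>N. (q i)\<^sup>2)"
proof -
  have int: "integrable circle_measure (\<lambda>u. of_real r * u powi k)" for r k
    by (intro integrable_circle continuous_intros) auto
  have "complex_of_real (\<integral>u. (norm (\<Sum>i\<le>N. of_real (q i) * u ^ i))\<^sup>2 \<partial>circle_measure) =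
      (\<integral>u. complex_of_real ((norm (\<Sum>i\<le>N. of_real (q i) * u ^ i))\<^sup>2) \<partial>circle_measure)"
    by (rule integral_complex_of_real[symmetric])
  also have "\<dots> = (\<integral>u. (\<Sum>i\<le>N. \<Sum>l\<le>N. of_real (q i * q l) * u powi (int i - int l)) \<partial>circle_measure)"
  proof (rule Bochner_Integration.integral_cong)
    fix u assume "u \<in> space circle_measure"
    then have u: "norm u = 1" by simp
    then have "u * cnj u = 1" "u \<noteq> 0" by (auto simp: complex_norm_square[symmetric])
    then have cu: "cnj u = inverse u" by (simp add: inverse_unique)
    have "complex_of_real ((norm (\<Sum>i\<le>N. of_real (q i) * u ^ i))\<^sup>2) =
        (\<Sum>i\<le>N. of_real (q i) * u ^ i) * cnj (\<Sum>i\<le>N. of_real (q i) * u ^ i)"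
      by (rule complex_norm_square)
    also have "\<dots> = (\<Sum>i\<le>N. \<Sum>l\<le>N. (of_real (q i) * u ^ i) * (of_real (q l) * inverse u ^ l))"
      by (simp add: sum_product cu)
    also have "\<dots> = (\<Sum>i\<le>N. \<Sum>l\<le>N. of_real (q i * q l) * u powi (int i - int l))"
      using \<open>u \<noteq> 0\<close> by (intro sum.cong) (auto simp: power_int_diff field_simps)
    finally show "complex_of_real ((norm (\<Sum>i\<le>N. of_real (q i) * u ^ i))\<^sup>2) =
        (\<Sum>i\<le>N. \<Sum>l\<le>N. of_real (q i * q l) * u powi (int i - int l))" .
  qed simp
  also have "\<dots> = (\<Sum>i\<le>N. \<Sum>l\<le>N. of_real (q i * q l) * (\<integral>u. u powi (int i - int l) \<partial>circle_measure))"
    by (simp add: Bochner_Integration.integral_sum Bochner_Integration.integrable_sum int del: of_real_mult)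
  also have "\<dots> = (\<Sum>i\<le>N. \<Sum>l\<le>N. if i = l then of_real (q i * q i) else 0)"
    by (intro sum.cong refl) (auto simp: integral_circle_power_int)
  also have "\<dots> = complex_of_real (\<Sum>i\<le>N. (q i)\<^sup>2)"
    by (simp add: power2_eq_square)
  finally show ?thesis by (simp only: of_real_eq_iff)
qed

text \<open>Multiplication by 1 - u takes backward differences of the coefficients, extended by zero
  on both sides.\<close>

lemma one_minus_mult_poly:
  fixes u :: "'a::comm_ring_1"
  shows "(1 - u) * (\<Sum>i\<le>n. q i * u ^ i) =
    (\<Sum>i\<le>Suc n. ((if i \<le> n then q i else 0) - (if i = 0 then 0 else q (i - 1))) * u ^ i)"
proof -
  have "(\<Sum>i\<le>Suc n. (if i \<le> n then q i else 0) * u ^ i) = (\<Sum>i\<le>n. q i * u ^ i)"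
    by simp
  moreover have "(\<Sum>i\<le>Suc n. (if i = 0 then 0 else q (i - 1)) * u ^ i) = u * (\<Sum>i\<le>n. q i * u ^ i)"
    by (subst sum.atMost_Suc_shift) (simp add: sum_distrib_left mult_ac)
  ultimately show ?thesis
    by (simp only: left_diff_distrib sum_subtractf mult_1_left)
qed

text \<open>Among the kernels \<open>|\<Sum> g\<^sub>i u\<^sup>i|\<^sup>2\<close>, the parabolic profile
  \<open>g\<^sub>i = (i + 1) (n + 1 - i)\<close> is nearly optimal for the second moment (the optimum is a sine)
  and keeps all sums polynomial.\<close>

definition kernel_weight :: "nat \<Rightarrow> nat \<Rightarrow> real" where
  "kernel_weight n i = (real i + 1) * (real n + 1 - real i)"

definition kernel_mass :: "nat \<Rightarrow> real" where
  "kernel_mass n = (\<Sum>i\<le>n. (kernel_weight n i)\<^sup>2)"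

definition kernel :: "nat \<Rightarrow> complex \<Rightarrow> real" where
  "kernel n u = (norm (\<Sum>i\<le>n. of_real (kernel_weight n i) * u ^ i))\<^sup>2 / kernel_mass n"

text \<open>Autocorrelation of the profile at lag k, normalised: the Fourier coefficient of
  \<open>kernel n\<close>.\<close>

definition kernel_coeff :: "nat \<Rightarrow> int \<Rightarrow> real" where
  "kernel_coeff n k =
    (\<Sum>i\<le>n. \<Sum>l\<le>n. if int i - int l = k then kernel_weight n i * kernel_weight n l else 0) / kernel_mass n"

lemma kernel_mass_eq: "kernel_mass n = (real n + 2) * ((real n + 2) ^ 4 - 1) / 30"
proof -
  \<comment> \<open>In the target n is both the range of summation and a parameter of the summand;
    induction needs the two separated. With j = i + 1 the summand is (j (x + 1) - j^2)^2, so the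
    right side collects the power sums of degrees 2, 3 and 4.\<close>
  have "(\<Sum>i\<le>k. ((real i + 1) * (x - real i))\<^sup>2) =
      (x + 1)\<^sup>2 * ((real k + 1) * (real k + 2) * (2 * real k + 3)) / 6
      - (x + 1) * ((real k + 1)\<^sup>2 * (real k + 2)\<^sup>2) / 2
      + (real k + 1) * (real k + 2) * (2 * real k + 3) * (3 * (real k + 1)\<^sup>2 + 3 * (real k + 1) - 1) / 30"
    for k :: nat and x :: real
    by (induction k) (simp_all add: field_simps power2_eq_square)
  from this[where k = n and x = "real n + 1"] show ?thesis
    unfolding kernel_mass_def kernel_weight_def
    by (simp add: field_simps power2_eq_square power4_eq_xxxx)
qed

lemma kernel_mass_pos: "0 < kernel_mass n"
proof -
  have "1 < (real n + 2) ^ 4" by (rule one_less_power) auto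
  then show ?thesis by (simp add: kernel_mass_eq)
qed

lemma kernel_nonneg: "0 \<le> kernel n u"
  using kernel_mass_pos[of n] by (simp add: kernel_def)

lemma continuous_on_kernel [continuous_intros]:
  "continuous_on S f \<Longrightarrow> continuous_on S (\<lambda>x. kernel n (f x))"
  using kernel_mass_pos[of n] unfolding kernel_def by (intro continuous_intros) auto

lemma kernel_cnj: "kernel n (cnj u) = kernel n u"
proof -
  have "(\<Sum>i\<le>n. of_real (kernel_weight n i) * cnj u ^ i) = cnj (\<Sum>i\<le>n. of_real (kernel_weight n i) * u ^ i)"
    by simp
  then show ?thesis by (simp only: kernel_def complex_mod_cnj)
qed

lemma integral_kernel: "(\<integral>u. kernel n u \<partial>circle_measure) = 1"
  using kernel_mass_pos[of n] by (simp add: kernel_def integral_circle_norm_poly kernel_mass_def)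

lemma kernel_expansion:
  assumes u: "norm u = 1"
  shows "complex_of_real (kernel n u) = (\<Sum>k\<in>{- int n..int n}. of_real (kernel_coeff n k) * u powi k)"
proof -
  let ?w = "kernel_weight n"
  have "u * cnj u = 1" "u \<noteq> 0" using u by (auto simp: complex_norm_square[symmetric])
  then have cu: "cnj u = inverse u" by (simp add: inverse_unique)
  have "complex_of_real ((norm (\<Sum>i\<le>n. of_real (?w i) * u ^ i))\<^sup>2) =
      (\<Sum>i\<le>n. of_real (?w i) * u ^ i) * cnj (\<Sum>i\<le>n. of_real (?w i) * u ^ i)"
    by (rule complex_norm_square)
  also have "\<dots> = (\<Sum>i\<le>n. \<Sum>l\<le>n. (of_real (?w i) * u ^ i) * (of_real (?w l) * inverse u ^ l))"
    by (simp add: sum_product cu)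
  also have "\<dots> = (\<Sum>i\<le>n. \<Sum>l\<le>n. of_real (?w i * ?w l) * u powi (int i - int l))"
    using \<open>u \<noteq> 0\<close> by (intro sum.cong) (auto simp: power_int_diff field_simps)
  also have "\<dots> = (\<Sum>i\<le>n. \<Sum>l\<le>n. \<Sum>k\<in>{- int n..int n}.
      if int i - int l = k then of_real (?w i * ?w l) * u powi k else 0)"
    by (intro sum.cong refl) auto
  also have "\<dots> = (\<Sum>k\<in>{- int n..int n}. \<Sum>i\<le>n. \<Sum>l\<le>n.
      if int i - int l = k then of_real (?w i * ?w l) * u powi k else 0)"
    by (simp only: sum.swap[of _ "{- int n..int n}"])
  also have "\<dots> = (\<Sum>k\<in>{- int n..int n}. of_real (\<Sum>i\<le>n. \<Sum>l\<le>n.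
      if int i - int l = k then ?w i * ?w l else 0) * u powi k)"
    unfolding of_real_sum sum_distrib_right by (intro sum.cong refl) auto
  finally have "complex_of_real (kernel n u) = (\<Sum>k\<in>{- int n..int n}. of_real (\<Sum>i\<le>n. \<Sum>l\<le>n.
      if int i - int l = k then ?w i * ?w l else 0) * u powi k) / of_real (kernel_mass n)"
    by (simp only: kernel_def of_real_divide)
  also have "\<dots> = (\<Sum>k\<in>{- int n..int n}. of_real (kernel_coeff n k) * u powi k)"
    by (subst sum_divide_distrib) (simp only: kernel_coeff_def of_real_divide times_divide_eq_left)
  finally show ?thesis .
qed

text \<open>On the circle 2 (1 - Re u) is |1 - u|^2, so the weight is absorbed into the polynomial:
  the integrand is a combination of |(1 - u) p|^2 and |(1 - u)^2 p|^2. Parseval then leaves the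
  squares of the first and second differences of the profile.\<close>

lemma kernel_second_moment:
  "(\<integral>u. kernel n u * (2 * (1 - Re u) + 2 * (1 - Re u)\<^sup>2) \<partial>circle_measure) \<le> 12 / (real n + 1)\<^sup>2"
proof -
  define p where "p u = (\<Sum>i\<le>n. of_real (kernel_weight n i) * u ^ i)" for u :: complex
  \<comment> \<open>The profile vanishes at i = -1 and i = n + 1, so this formula for its first
    difference holds at both ends as well. The second difference is the constant -2 of a parabola
    except at the two boundary indices.\<close>
  define h1 where "h1 i = real n + 1 - 2 * real i" for i
  define h2 where "h2 i = (if i = 0 \<or> i = n + 2 then real n + 1 else - 2)" for i
  define A where "A u = (\<Sum>i\<le>Suc n. of_real (h1 i) * u ^ i)" for u :: complex
  define B where "B u = (\<Sum>i\<le>Suc (Suc n). of_real (h2 i) * u ^ i)" for u :: complex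
  define L where "L = real n + 2"
  have A: "(1 - u) * p u = A u" for u
    unfolding p_def A_def one_minus_mult_poly
  proof (intro sum.cong refl arg_cong2[where f = times])
    fix i assume "i \<in> {..Suc n}"
    then have "i \<le> Suc n" by simp
    have "(if i \<le> n then kernel_weight n i else 0) - (if i = 0 then 0 else kernel_weight n (i - 1)) = h1 i"
    proof (cases i)
      case (Suc j)
      then show ?thesis using \<open>i \<le> Suc n\<close>
        by (cases "j = n") (auto simp: kernel_weight_def h1_def algebra_simps)
    qed (simp add: kernel_weight_def h1_def)
    from arg_cong[OF this, of complex_of_real]
    show "(if i \<le> n then complex_of_real (kernel_weight n i) else 0) -
        (if i = 0 then 0 else complex_of_real (kernel_weight n (i - 1))) = of_real (h1 i)"
      by (simp split: if_splits)
  qed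
  have B: "(1 - u) * A u = B u" for u
    unfolding A_def B_def one_minus_mult_poly
  proof (intro sum.cong refl arg_cong2[where f = times])
    fix i assume "i \<in> {..Suc (Suc n)}"
    then have "i \<le> Suc (Suc n)" by simp
    have "(if i \<le> Suc n then h1 i else 0) - (if i = 0 then 0 else h1 (i - 1)) = h2 i"
    proof (cases i)
      case (Suc j)
      then show ?thesis using \<open>i \<le> Suc (Suc n)\<close>
        by (cases "j = Suc n") (auto simp: h1_def h2_def)
    qed (simp add: h1_def h2_def)
    from arg_cong[OF this, of complex_of_real]
    show "(if i \<le> Suc n then complex_of_real (h1 i) else 0) -
        (if i = 0 then 0 else complex_of_real (h1 (i - 1))) = of_real (h2 i)"
      by (simp split: if_splits)
  qed
  have cont: "continuous_on (sphere 0 1) (\<lambda>u. (norm (A u))\<^sup>2)" "continuous_on (sphere 0 1) (\<lambda>u. (norm (B u))\<^sup>2)"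
    unfolding A_def B_def by (intro continuous_intros)+
  have "(\<integral>u. kernel n u * (2 * (1 - Re u) + 2 * (1 - Re u)\<^sup>2) \<partial>circle_measure) =
      (\<integral>u. ((norm (A u))\<^sup>2 + (norm (B u))\<^sup>2 / 2) / kernel_mass n \<partial>circle_measure)"
  proof (rule Bochner_Integration.integral_cong)
    fix u assume "u \<in> space circle_measure"
    then have "norm u = 1" by simp
    then have s: "2 * (1 - Re u) = (norm (1 - u))\<^sup>2"
      using cmod_power2[of u] by (simp add: cmod_power2 power2_diff)
    have s2: "2 * (1 - Re u) + 2 * (1 - Re u)\<^sup>2 = (norm (1 - u))\<^sup>2 + ((norm (1 - u))\<^sup>2)\<^sup>2 / 2"
      unfolding s[symmetric] by (simp add: power2_eq_square field_simps)
    have "(norm (B u))\<^sup>2 = (norm (1 - u))\<^sup>2 * ((norm (1 - u))\<^sup>2 * (norm (p u))\<^sup>2)"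
      by (simp add: A[symmetric] B[symmetric] norm_mult power_mult_distrib)
    moreover have "(norm (A u))\<^sup>2 = (norm (1 - u))\<^sup>2 * (norm (p u))\<^sup>2"
      by (simp add: A[symmetric] norm_mult power_mult_distrib)
    ultimately show "kernel n u * (2 * (1 - Re u) + 2 * (1 - Re u)\<^sup>2) =
        ((norm (A u))\<^sup>2 + (norm (B u))\<^sup>2 / 2) / kernel_mass n"
      unfolding kernel_def p_def[symmetric] s2 by (simp add: power2_eq_square field_simps)
  qed simp
  also have "\<dots> = ((\<Sum>i\<le>Suc n. (h1 i)\<^sup>2) + (\<Sum>i\<le>Suc (Suc n). (h2 i)\<^sup>2) / 2) / kernel_mass n"
    using integrable_circle[OF cont(1)] integrable_circle[OF cont(2)]
    by (simp add: integral_circle_norm_poly A_def B_def del: sum.atMost_Suc)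
  also have "(\<Sum>i\<le>Suc n. (h1 i)\<^sup>2) = L * (L\<^sup>2 - 1) / 3"
  proof -
    have "(\<Sum>i\<le>k. (x - 2 * real i)\<^sup>2) =
        (real k + 1) * x\<^sup>2 - 2 * x * (real k * (real k + 1)) + 4 * (real k * (real k + 1) * (2 * real k + 1)) / 6"
      for k :: nat and x :: real
      by (induction k) (simp_all add: field_simps power2_eq_square)
    from this[where k = "Suc n" and x = "real n + 1"] show ?thesis
      unfolding h1_def L_def by (simp add: field_simps power2_eq_square del: sum.atMost_Suc)
  qed
  also have "(\<Sum>i\<le>Suc (Suc n). (h2 i)\<^sup>2) = 2 * (L\<^sup>2 - 1)"
  proof -
    have "(\<Sum>i\<le>Suc (Suc n). (h2 i)\<^sup>2) = (h2 0)\<^sup>2 + (\<Sum>i\<le>n. (h2 (Suc i))\<^sup>2) + (h2 (Suc (Suc n)))\<^sup>2"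
      by (subst sum.atMost_Suc, subst sum.atMost_Suc_shift) simp
    also have "(\<Sum>i\<le>n. (h2 (Suc i))\<^sup>2) = (\<Sum>i\<le>n. 4)"
      by (intro sum.cong) (auto simp: h2_def)
    finally show ?thesis by (simp add: h2_def L_def power2_eq_square algebra_simps)
  qed
  also have "(L * (L\<^sup>2 - 1) / 3 + 2 * (L\<^sup>2 - 1) / 2) / kernel_mass n = (10 * L + 30) / (L * (L\<^sup>2 + 1))"
  proof -
    have "L \<ge> 2" by (simp add: L_def)
    then have "L\<^sup>2 > 1" by (intro one_less_power) auto
    have m: "kernel_mass n = L * ((L\<^sup>2 - 1) * (L\<^sup>2 + 1)) / 30"
      by (simp add: kernel_mass_eq L_def[symmetric] power2_eq_square power4_eq_xxxx algebra_simps)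
    have "L \<noteq> 0" "L\<^sup>2 - 1 \<noteq> 0" "L\<^sup>2 + 1 \<noteq> 0" using \<open>L \<ge> 2\<close> \<open>L\<^sup>2 > 1\<close> by linarith+
    have "(L * (L\<^sup>2 - 1) / 3 + 2 * (L\<^sup>2 - 1) / 2) = (L\<^sup>2 - 1) * (10 * L + 30) / 30"
      by (simp add: field_simps)
    then show ?thesis unfolding m using \<open>L \<noteq> 0\<close> \<open>L\<^sup>2 - 1 \<noteq> 0\<close> \<open>L\<^sup>2 + 1 \<noteq> 0\<close> by simp
  qed
  also have "\<dots> \<le> 12 / (real n + 1)\<^sup>2"
  proof -
    define y where "y = real n"
    have y: "y \<ge> 0" by (simp add: y_def)
    have "(10 * L + 30) * (real n + 1)\<^sup>2 \<le> 12 * (L * (L\<^sup>2 + 1))"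
    proof -
      \<comment> \<open>The exact moment behaves like 10 / L^2 for large n. The constant 12 leaves
        enough room for all n: the cleared difference is a polynomial in n with positive
        coefficients.\<close>
      have "12 * (L * (L\<^sup>2 + 1)) - (10 * L + 30) * (y + 1)\<^sup>2 = 2 * y ^ 3 + 2 * y\<^sup>2 + 46 * y + 70"
        by (simp add: L_def y_def[symmetric] power2_eq_square power3_eq_cube algebra_simps)
      moreover have "0 \<le> 2 * y ^ 3 + 2 * y\<^sup>2 + 46 * y + 70" using y by simp
      ultimately have "(10 * L + 30) * (y + 1)\<^sup>2 \<le> 12 * (L * (L\<^sup>2 + 1))" by linarith
      then show ?thesis by (simp add: y_def)
    qed
    moreover have "0 < L * (L\<^sup>2 + 1)" by (simp add: L_def add_nonneg_pos)
    moreover have "0 < (real n + 1)\<^sup>2" by simp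
    ultimately have "10 * L + 30 \<le> 12 * (L * (L\<^sup>2 + 1)) / (real n + 1)\<^sup>2"
      by (intro mult_imp_le_div_pos)
    then show ?thesis
      using \<open>0 < L * (L\<^sup>2 + 1)\<close> by (intro mult_imp_div_pos_le) simp_all
  qed
  finally show ?thesis .
qed

section \<open>Smoothing of Lipschitz functions\<close>

lemma continuous_on_vec_times [continuous_intros]:
  fixes f g :: "'a::topological_space \<Rightarrow> complex ^ 'n"
  assumes "continuous_on S f" "continuous_on S g"
  shows "continuous_on S (\<lambda>x. f x * g x)"
  unfolding times_vec_def using assms by (intro continuous_intros)

lemma continuous_on_torus_translate:
  fixes F :: "complex ^ 'n \<Rightarrow> 'b::topological_space"
  assumes F: "continuous_on torus F" and a: "a \<in> torus"
  shows "continuous_on torus (\<lambda>w. F (a * w))"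
proof (rule continuous_on_compose2[OF F])
  show "continuous_on torus (\<lambda>w. a * w)" by (intro continuous_intros)
qed (use torus_mult[OF a] in auto)

text \<open>On the torus this is the group inverse.\<close>

definition torus_cnj :: "complex ^ 'n \<Rightarrow> complex ^ 'n" where
  "torus_cnj z = (\<chi> j. cnj (z $ j))"

lemma torus_cnj_in_torus: "z \<in> torus \<Longrightarrow> torus_cnj z \<in> torus"
  by (rule torusI) (simp add: torus_cnj_def torus_norm)

lemma torus_cnj_mult_cancel: "z \<in> torus \<Longrightarrow> torus_cnj z * (z * w) = w"
proof -
  assume z: "z \<in> torus"
  have "cnj (z $ j) * (z $ j * w $ j) = w $ j" for j
  proof -
    have "cnj (z $ j) * (z $ j * w $ j) = (z $ j * cnj (z $ j)) * w $ j" by (simp only: mult_ac)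
    also have "z $ j * cnj (z $ j) = 1" by (simp add: complex_norm_square[symmetric] torus_norm[OF z])
    finally show ?thesis by simp
  qed
  then show ?thesis by (simp add: vec_eq_iff torus_cnj_def)
qed

lemma torus_char_torus_cnj: "torus_char m (torus_cnj z) = cnj (torus_char m z)"
  by (simp add: torus_char_def torus_cnj_def)

text \<open>Parseval on the torus, applied below to the partial derivatives of the smoothed
  function.\<close>

lemma integral_torus_trig_poly:
  fixes b :: "('n::finite \<Rightarrow> int) \<Rightarrow> complex"
  assumes B: "finite B"
  shows "(\<integral>z. (norm (\<Sum>m\<in>B. b m * torus_char m z))\<^sup>2 \<partial>torus_measure) = (\<Sum>m\<in>B. (norm (b m))\<^sup>2)"
proof -
  interpret prob_space "torus_measure :: (complex ^ 'n) measure" by (rule prob_space_torus_measure)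
  have char: "continuous_on torus (torus_char m)" for m :: "'n \<Rightarrow> int"
    using continuous_on_torus_char[of torus "\<lambda>z. z" m] by simp
  have int: "integrable torus_measure (\<lambda>z. c * torus_char m z)" for c and m :: "'n \<Rightarrow> int"
    by (intro integrable_torus continuous_intros char) (auto intro: finite_measure_axioms)
  have "complex_of_real (\<integral>z. (norm (\<Sum>m\<in>B. b m * torus_char m z))\<^sup>2 \<partial>torus_measure) =
      (\<integral>z. complex_of_real ((norm (\<Sum>m\<in>B. b m * torus_char m z))\<^sup>2) \<partial>torus_measure)"
    by (rule integral_complex_of_real[symmetric])
  also have "\<dots> = (\<integral>z. (\<Sum>m\<in>B. \<Sum>k\<in>B. (b m * cnj (b k)) * torus_char (\<lambda>j. m j + - k j) z) \<partial>torus_measure)"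
  proof (rule Bochner_Integration.integral_cong)
    fix z :: "complex ^ 'n" assume "z \<in> space torus_measure"
    then have z: "z \<in> torus" by simp
    have "complex_of_real ((norm (\<Sum>m\<in>B. b m * torus_char m z))\<^sup>2) =
        (\<Sum>m\<in>B. b m * torus_char m z) * cnj (\<Sum>m\<in>B. b m * torus_char m z)"
      by (rule complex_norm_square)
    also have "\<dots> = (\<Sum>m\<in>B. \<Sum>k\<in>B. (b m * torus_char m z) * (cnj (b k) * torus_char (\<lambda>j. - k j) z))"
      using z by (simp add: sum_product cnj_torus_char)
    also have "\<dots> = (\<Sum>m\<in>B. \<Sum>k\<in>B. (b m * cnj (b k)) * torus_char (\<lambda>j. m j + - k j) z)"
      using z by (intro sum.cong refl) (simp only: torus_char_add mult_ac)
    finally show "complex_of_real ((norm (\<Sum>m\<in>B. b m * torus_char m z))\<^sup>2) =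
        (\<Sum>m\<in>B. \<Sum>k\<in>B. (b m * cnj (b k)) * torus_char (\<lambda>j. m j + - k j) z)" .
  qed simp
  also have "\<dots> = (\<Sum>m\<in>B. \<Sum>k\<in>B. (b m * cnj (b k)) * (\<integral>z. torus_char (\<lambda>j. m j + - k j) z \<partial>torus_measure))"
    by (simp add: Bochner_Integration.integral_sum Bochner_Integration.integrable_sum int)
  also have "\<dots> = (\<Sum>m\<in>B. \<Sum>k\<in>B. if k = m then b m * cnj (b m) else 0)"
  proof (intro sum.cong refl)
    fix m k :: "'n \<Rightarrow> int"
    have "(\<lambda>j. m j + - k j) = (\<lambda>_. 0) \<longleftrightarrow> k = m" by (auto simp: fun_eq_iff)
    then show "(b m * cnj (b k)) * (\<integral>z. torus_char (\<lambda>j. m j + - k j) z \<partial>torus_measure) =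
        (if k = m then b m * cnj (b m) else 0)"
      by (simp only: integral_torus_char) simp
  qed
  also have "\<dots> = complex_of_real (\<Sum>m\<in>B. (norm (b m))\<^sup>2)"
    using B by (simp only: sum.delta if_True of_real_sum complex_norm_square cong: sum.cong)
  finally show ?thesis by (simp only: of_real_eq_iff)
qed

section \<open>Product kernels and convolution on the torus\<close>

definition freq_box :: "nat \<Rightarrow> ('n \<Rightarrow> int) set" where
  "freq_box n = PiE UNIV (\<lambda>_. {- int n..int n})"

lemma finite_freq_box: "finite (freq_box n :: ('n::finite \<Rightarrow> int) set)"
  unfolding freq_box_def by (intro finite_PiE) auto

lemma freq_box_iff: "m \<in> freq_box n \<longleftrightarrow> (\<forall>j. \<bar>m j\<bar> \<le> int n)"
  by (auto simp: freq_box_def PiE_iff abs_le_iff minus_le_iff)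

definition torus_kernel :: "nat \<Rightarrow> complex ^ 'n \<Rightarrow> real" where
  "torus_kernel n z = (\<Prod>j\<in>UNIV. kernel n (z $ j))"

lemma torus_kernel_nonneg: "0 \<le> torus_kernel n z"
  unfolding torus_kernel_def by (intro prod_nonneg) (simp add: kernel_nonneg)

lemma torus_kernel_cnj: "torus_kernel n (torus_cnj z) = torus_kernel n z"
  by (simp add: torus_kernel_def torus_cnj_def kernel_cnj)

lemma continuous_on_torus_kernel [continuous_intros]:
  "continuous_on S f \<Longrightarrow> continuous_on S (\<lambda>x. torus_kernel n (f x))"
  unfolding torus_kernel_def by (intro continuous_intros)

lemma torus_kernel_expansion:
  assumes z: "z \<in> torus"
  shows "complex_of_real (torus_kernel n z) =
    (\<Sum>m\<in>freq_box n. of_real (\<Prod>j\<in>UNIV. kernel_coeff n (m j)) * torus_char m z)"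
proof -
  have "complex_of_real (torus_kernel n z) =
      (\<Prod>j\<in>UNIV. \<Sum>k\<in>{- int n..int n}. of_real (kernel_coeff n k) * (z $ j) powi k)"
    by (simp add: torus_kernel_def kernel_expansion torus_norm[OF z])
  also have "\<dots> = (\<Sum>m\<in>freq_box n. \<Prod>j\<in>UNIV. of_real (kernel_coeff n (m j)) * (z $ j) powi m j)"
    unfolding freq_box_def by (rule prod_sum_PiE) auto
  finally show ?thesis by (simp add: torus_char_def prod.distrib)
qed

lemma integral_torus_kernel: "(\<integral>z. torus_kernel n z \<partial>(torus_measure :: (complex ^ 'n) measure)) = 1"
proof -
  have "(\<integral>z. torus_kernel n z \<partial>(torus_measure :: (complex ^ 'n) measure)) =
      (\<Prod>j\<in>(UNIV :: 'n set). \<integral>u. kernel n u \<partial>circle_measure)"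
    unfolding torus_kernel_def by (rule integral_torus_prod) (intro continuous_intros)
  then show ?thesis by (simp add: integral_kernel)
qed

text \<open>Only factor j carries the weight and every other factor integrates to 1, so the
  one-dimensional bound holds in each coordinate with no loss in the dimension.\<close>

lemma torus_kernel_second_moment:
  fixes j :: "'n::finite"
  shows "(\<integral>z. torus_kernel n z * (2 * (1 - Re (z $ j)) + 2 * (1 - Re (z $ j))\<^sup>2) \<partial>torus_measure)
    \<le> 12 / (real n + 1)\<^sup>2"
proof -
  define q where "q u = 2 * (1 - Re u) + 2 * (1 - Re u)\<^sup>2" for u
  have "(\<integral>z. torus_kernel n z * q (z $ j) \<partial>torus_measure) =
      (\<integral>z. (\<Prod>i\<in>UNIV. kernel n (z $ i) * (if i = j then q (z $ i) else 1)) \<partial>torus_measure)"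
    by (simp add: torus_kernel_def prod.distrib)
  also have "\<dots> = (\<Prod>i\<in>UNIV. \<integral>u. kernel n u * (if i = j then q u else 1) \<partial>circle_measure)"
  proof (rule integral_torus_prod)
    fix i
    show "continuous_on (sphere 0 1) (\<lambda>u. kernel n u * (if i = j then q u else 1))"
      by (cases "i = j") (auto simp: q_def intro!: continuous_on_kernel continuous_on_mult continuous_on_add
          continuous_on_diff continuous_on_power continuous_on_Re continuous_on_const continuous_on_id)
  qed
  also have "\<dots> = (\<Prod>i\<in>UNIV. if i = j then \<integral>u. kernel n u * q u \<partial>circle_measure else 1)"
    by (intro prod.cong) (auto simp: integral_kernel)
  also have "\<dots> = (\<integral>u. kernel n u * q u \<partial>circle_measure)"
    by simp
  also have "\<dots> \<le> 12 / (real n + 1)\<^sup>2"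
    unfolding q_def by (rule kernel_second_moment)
  finally show ?thesis by (simp add: q_def)
qed

definition torus_smooth :: "nat \<Rightarrow> (complex ^ 'n \<Rightarrow> real) \<Rightarrow> complex ^ 'n \<Rightarrow> real" where
  "torus_smooth n F z = (\<integral>w. F (z * w) * torus_kernel n w \<partial>torus_measure)"

definition smooth_coeff :: "nat \<Rightarrow> (complex ^ 'n \<Rightarrow> real) \<Rightarrow> ('n \<Rightarrow> int) \<Rightarrow> complex" where
  "smooth_coeff n F m = of_real (\<Prod>j\<in>UNIV. kernel_coeff n (m j)) *
    (\<integral>w. of_real (F w) * cnj (torus_char m w) \<partial>torus_measure)"

text \<open>Rotation invariance moves z out of \<open>F\<close>, which is merely continuous, into
  the kernel, whose expansion is explicit. Evenness of the kernel then exchanges the inverse of z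
  with z itself.\<close>

lemma torus_smooth_expansion:
  fixes F :: "complex ^ 'n \<Rightarrow> real"
  assumes F: "continuous_on torus F" and z: "z \<in> torus"
  shows "complex_of_real (torus_smooth n F z) = (\<Sum>m\<in>freq_box n. smooth_coeff n F m * torus_char m z)"
proof -
  interpret prob_space "torus_measure :: (complex ^ 'n) measure" by (rule prob_space_torus_measure)
  let ?C = "\<lambda>m. complex_of_real (\<Prod>j\<in>UNIV. kernel_coeff n (m j))"
  have char: "continuous_on torus (torus_char m)" for m :: "'n \<Rightarrow> int"
    using continuous_on_torus_char[of torus "\<lambda>z. z" m] by simp
  have int: "integrable torus_measure (\<lambda>w. c * (complex_of_real (F w) * cnj (torus_char m w)))"
    for c and m :: "'n \<Rightarrow> int"
    by (intro integrable_torus continuous_intros char F) (auto intro: finite_measure_axioms)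
  have "torus_smooth n F z = (\<integral>w. F (z * w) * torus_kernel n (torus_cnj z * (z * w)) \<partial>torus_measure)"
    using z by (simp add: torus_smooth_def torus_cnj_mult_cancel)
  also have "\<dots> = (\<integral>w. F w * torus_kernel n (torus_cnj z * w) \<partial>torus_measure)"
    by (rule integral_torus_rotation[OF z, of "\<lambda>w. F w * torus_kernel n (torus_cnj z * w)"])
      (intro continuous_intros F)
  also have "\<dots> = (\<integral>w. F w * torus_kernel n (z * torus_cnj w) \<partial>torus_measure)"
  proof -
    have "torus_cnj z * w = torus_cnj (z * torus_cnj w)" for w
      by (simp add: vec_eq_iff torus_cnj_def)
    then show ?thesis by (simp add: torus_kernel_cnj)
  qed
  finally have "complex_of_real (torus_smooth n F z) =
      (\<integral>w. complex_of_real (F w * torus_kernel n (z * torus_cnj w)) \<partial>torus_measure)"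
    by (simp only: integral_complex_of_real)
  also have "\<dots> = (\<integral>w. (\<Sum>m\<in>freq_box n. (?C m * torus_char m z) * (of_real (F w) * cnj (torus_char m w))) \<partial>torus_measure)"
  proof (rule Bochner_Integration.integral_cong)
    fix w :: "complex ^ 'n" assume "w \<in> space torus_measure"
    then have w: "w \<in> torus" by simp
    have zw: "z * torus_cnj w \<in> torus" using z w by (intro torus_mult torus_cnj_in_torus)
    show "complex_of_real (F w * torus_kernel n (z * torus_cnj w)) =
        (\<Sum>m\<in>freq_box n. (?C m * torus_char m z) * (of_real (F w) * cnj (torus_char m w)))"
      unfolding of_real_mult torus_kernel_expansion[OF zw] torus_char_mult torus_char_torus_cnj sum_distrib_left
      by (intro sum.cong refl) (simp only: mult_ac)
  qed simp
  also have "\<dots> = (\<Sum>m\<in>freq_box n. (?C m * torus_char m z) *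
      (\<integral>w. of_real (F w) * cnj (torus_char m w) \<partial>torus_measure))"
    by (subst Bochner_Integration.integral_sum) (simp_all only: int integral_mult_right_zero)
  finally show ?thesis
    by (simp add: smooth_coeff_def mult_ac)
qed

text \<open>The point z cancels in the quotients; what remains is bounded coordinatewise by the
  polynomial that the kernel can integrate.\<close>

lemma torus_dist_translate:
  assumes "z \<in> torus" "w \<in> torus"
  shows "torus_dist z (z * w) \<le> sqrt (\<Sum>j\<in>UNIV. 2 * (1 - Re (w $ j)) + 2 * (1 - Re (w $ j))\<^sup>2)"
  unfolding torus_dist_def
proof (intro real_sqrt_le_mono sum_mono)
  fix j
  have n: "norm (z $ j) = 1" "norm (w $ j) = 1" using assms by (simp_all add: torus_norm)
  have "z $ j * cnj (z $ j * w $ j) = (z $ j * cnj (z $ j)) * cnj (w $ j)" by simp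
  also have "z $ j * cnj (z $ j) = 1" by (simp add: complex_norm_square[symmetric] n)
  finally have eq: "z $ j * cnj (z $ j * w $ j) = cnj (w $ j)" by simp
  have "arc_dist (z $ j) ((z * w) $ j) = \<bar>Arg (z $ j * cnj (z $ j * w $ j))\<bar>"
    using n by (simp add: arc_dist_eq norm_mult del: complex_cnj_mult)
  then have "arc_dist (z $ j) ((z * w) $ j) = \<bar>Arg (cnj (w $ j))\<bar>"
    unfolding eq .
  then show "(arc_dist (z $ j) ((z * w) $ j))\<^sup>2 \<le> 2 * (1 - Re (w $ j)) + 2 * (1 - Re (w $ j))\<^sup>2"
    using Arg_square_le[of "cnj (w $ j)"] n by simp
qed

text \<open>Instead of Cauchy-Schwarz for the kernel measure, the root is linearised pointwise: sqrt
  X is at most X / (2 c) + c / 2. With c^2 equal to the bound on the mean of X, the sum over the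
  coordinates of 12 / (n + 1)^2, each half contributes at most c / 2.\<close>

lemma torus_smooth_close:
  fixes F :: "complex ^ 'n \<Rightarrow> real"
  assumes lip: "\<And>x y. x \<in> torus \<Longrightarrow> y \<in> torus \<Longrightarrow> F x - F y \<le> torus_dist x y" and z: "z \<in> torus"
  shows "\<bar>F z - torus_smooth n F z\<bar> \<le> 2 * sqrt 3 * sqrt (real CARD('n)) / (real n + 1)"
proof -
  interpret prob_space "torus_measure :: (complex ^ 'n) measure" by (rule prob_space_torus_measure)
  note fm = finite_measure_axioms
  have F: "continuous_on torus F" using lip by (rule continuous_on_torus_lipschitz)
  define q where "q u = 2 * (1 - Re u) + 2 * (1 - Re u)\<^sup>2" for u
  define c where "c = 2 * sqrt 3 * sqrt (real CARD('n)) / (real n + 1)"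
  have c: "c > 0" by (simp add: c_def zero_less_card_finite)
  have c2: "c\<^sup>2 = real CARD('n) * (12 / (real n + 1)\<^sup>2)"
    by (simp add: c_def power_divide power_mult_distrib)
  have int_kernel: "integrable torus_measure (torus_kernel n :: complex ^ 'n \<Rightarrow> real)"
    by (intro integrable_torus fm continuous_on_torus_kernel continuous_on_id) simp
  have int_F: "integrable torus_measure (\<lambda>w. F (z * w) * torus_kernel n w)"
    by (intro integrable_torus fm continuous_on_mult continuous_on_torus_translate F z
        continuous_on_torus_kernel continuous_on_id) simp
  have int_q: "integrable torus_measure (\<lambda>w :: complex ^ 'n. torus_kernel n w * q (w $ j))" for j
    unfolding q_def by (intro integrable_torus fm continuous_intros) simp
  have "F z - torus_smooth n F z = (\<integral>w. (F z - F (z * w)) * torus_kernel n w \<partial>torus_measure)"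
    using int_F int_kernel by (simp add: left_diff_distrib integral_torus_kernel torus_smooth_def)
  also have "\<bar>\<dots>\<bar> \<le> (\<integral>w. (\<Sum>j\<in>UNIV. torus_kernel n w * q (w $ j)) / (2 * c) + c / 2 * torus_kernel n w
      \<partial>(torus_measure :: (complex ^ 'n) measure))"
  proof (rule integral_abs_bound_integral)
    show "integrable torus_measure (\<lambda>w. (F z - F (z * w)) * torus_kernel n w)"
      using int_F int_kernel by (simp add: left_diff_distrib)
    show "integrable torus_measure (\<lambda>w :: complex ^ 'n. (\<Sum>j\<in>UNIV. torus_kernel n w * q (w $ j)) / (2 * c) + c / 2 * torus_kernel n w)"
      by (intro Bochner_Integration.integrable_add integrable_divide_zero integrable_mult_right
          Bochner_Integration.integrable_sum) (simp_all add: int_q int_kernel)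
    fix w :: "complex ^ 'n" assume "w \<in> space torus_measure"
    then have w: "w \<in> torus" by simp
    have zw: "z * w \<in> torus" using z w by (rule torus_mult)
    define X where "X = (\<Sum>j\<in>UNIV. q (w $ j))"
    have "X \<ge> 0"
      unfolding X_def q_def using abs_Re_le_cmod[of "w $ _"] torus_norm[OF w]
      by (intro sum_nonneg add_nonneg_nonneg mult_nonneg_nonneg) (auto simp: abs_le_iff)
    have "\<bar>F z - F (z * w)\<bar> \<le> torus_dist z (z * w)"
      using lip[OF z zw] lip[OF zw z] by (simp add: torus_dist_sym abs_le_iff)
    also have "\<dots> \<le> sqrt X"
      using torus_dist_translate[OF z w] by (simp add: X_def q_def)
    also have "\<dots> \<le> X / (2 * c) + c / 2"
    proof -
      have "0 \<le> (sqrt X - c)\<^sup>2" by simp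
      then have "2 * c * sqrt X \<le> X + c\<^sup>2" using \<open>X \<ge> 0\<close> by (simp add: power2_diff algebra_simps)
      then show ?thesis using c by (simp add: field_simps power2_eq_square)
    qed
    finally have "\<bar>F z - F (z * w)\<bar> * torus_kernel n w \<le> (X / (2 * c) + c / 2) * torus_kernel n w"
      by (intro mult_right_mono torus_kernel_nonneg)
    moreover have S: "(\<Sum>j\<in>UNIV. torus_kernel n w * q (w $ j)) = torus_kernel n w * X"
      by (simp add: X_def sum_distrib_left)
    ultimately show "\<bar>(F z - F (z * w)) * torus_kernel n w\<bar> \<le>
        (\<Sum>j\<in>UNIV. torus_kernel n w * q (w $ j)) / (2 * c) + c / 2 * torus_kernel n w"
      unfolding S abs_mult abs_of_nonneg[OF torus_kernel_nonneg] by (simp add: algebra_simps)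
  qed
  also have "\<dots> = (\<Sum>j\<in>UNIV. \<integral>w. torus_kernel n w * q (w $ j) \<partial>(torus_measure :: (complex ^ 'n) measure)) / (2 * c) + c / 2"
    using int_q int_kernel by (simp add: integral_torus_kernel Bochner_Integration.integral_sum)
  also have "\<dots> \<le> (\<Sum>j\<in>(UNIV :: 'n set). 12 / (real n + 1)\<^sup>2) / (2 * c) + c / 2"
    using c torus_kernel_second_moment[of n, where 'n = 'n]
    by (intro add_right_mono divide_right_mono sum_mono) (auto simp: q_def)
  also have "\<dots> = c\<^sup>2 / (2 * c) + c / 2" by (simp add: c2)
  also have "\<dots> = c" using c by (simp add: power2_eq_square)
  finally show ?thesis by (simp add: c_def)
qed

text \<open>The metric is rotation invariant, so all translates of \<open>F\<close> share its
  Lipschitz bound, and averaging them against a nonnegative kernel of mass 1 preserves it.\<close>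

lemma torus_smooth_lipschitz:
  fixes F :: "complex ^ 'n \<Rightarrow> real"
  assumes lip: "\<And>x y. x \<in> torus \<Longrightarrow> y \<in> torus \<Longrightarrow> F x - F y \<le> torus_dist x y"
    and z: "z \<in> torus" and y: "y \<in> torus"
  shows "torus_smooth n F z - torus_smooth n F y \<le> torus_dist z y"
proof -
  interpret prob_space "torus_measure :: (complex ^ 'n) measure" by (rule prob_space_torus_measure)
  note fm = finite_measure_axioms
  have F: "continuous_on torus F" using lip by (rule continuous_on_torus_lipschitz)
  have int_kernel: "integrable torus_measure (torus_kernel n :: complex ^ 'n \<Rightarrow> real)"
    by (intro integrable_torus fm continuous_on_torus_kernel continuous_on_id) simp
  have int_F: "integrable torus_measure (\<lambda>w. F (x * w) * torus_kernel n w)" if "x \<in> torus" for x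
    by (intro integrable_torus fm continuous_on_mult continuous_on_torus_translate F that
        continuous_on_torus_kernel continuous_on_id) simp
  have "torus_smooth n F z - torus_smooth n F y =
      (\<integral>w. F (z * w) * torus_kernel n w - F (y * w) * torus_kernel n w \<partial>torus_measure)"
    using int_F z y by (simp add: torus_smooth_def)
  also have "\<dots> \<le> (\<integral>w. torus_dist z y * torus_kernel n w \<partial>(torus_measure :: (complex ^ 'n) measure))"
  proof (rule integral_mono)
    fix w :: "complex ^ 'n" assume "w \<in> space torus_measure"
    then have w: "w \<in> torus" by simp
    have "arc_dist ((z * w) $ j) ((y * w) $ j) = arc_dist (z $ j) (y $ j)" for j
    proof -
      have "(z $ j * w $ j) * cnj (y $ j * w $ j) = (z $ j * cnj (y $ j)) * (w $ j * cnj (w $ j))"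
        by (simp add: mult_ac)
      also have "w $ j * cnj (w $ j) = 1" by (simp add: complex_norm_square[symmetric] torus_norm[OF w])
      finally have eq: "(z $ j * w $ j) * cnj (y $ j * w $ j) = z $ j * cnj (y $ j)" by simp
      have "arc_dist ((z * w) $ j) ((y * w) $ j) = \<bar>Arg ((z $ j * w $ j) * cnj (y $ j * w $ j))\<bar>"
        using z y w by (simp add: arc_dist_eq torus_norm norm_mult del: complex_cnj_mult)
      also have "\<dots> = arc_dist (z $ j) (y $ j)"
        unfolding eq using z y by (simp add: arc_dist_eq torus_norm)
      finally show ?thesis .
    qed
    then have "torus_dist (z * w) (y * w) = torus_dist z y" by (simp add: torus_dist_def)
    then have "F (z * w) - F (y * w) \<le> torus_dist z y"
      using lip[OF torus_mult[OF z w] torus_mult[OF y w]] by simp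
    then have "(F (z * w) - F (y * w)) * torus_kernel n w \<le> torus_dist z y * torus_kernel n w"
      by (intro mult_right_mono torus_kernel_nonneg)
    then show "F (z * w) * torus_kernel n w - F (y * w) * torus_kernel n w \<le> torus_dist z y * torus_kernel n w"
      by (simp add: left_diff_distrib)
  qed (use int_F z y int_kernel in auto)
  also have "\<dots> = torus_dist z y" by (simp add: integral_torus_kernel)
  finally show ?thesis .
qed

section \<open>Gradient of the smoothed function\<close>

lemma DERIV_abs_le:
  fixes f :: "real \<Rightarrow> real"
  assumes "(f has_real_derivative D) (at 0)" and "\<And>t. \<bar>f t - f 0\<bar> \<le> B * \<bar>t\<bar>"
  shows "\<bar>D\<bar> \<le> B"
proof -
  have "((\<lambda>h. (f (0 + h) - f 0) / h) \<longlongrightarrow> D) (at 0)"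
    using assms(1) by (rule DERIV_D)
  then have "((\<lambda>h. \<bar>(f (0 + h) - f 0) / h\<bar>) \<longlongrightarrow> \<bar>D\<bar>) (at 0)"
    by (rule tendsto_rabs)
  moreover have "eventually (\<lambda>h. \<bar>(f (0 + h) - f 0) / h\<bar> \<le> B) (at 0)"
    using assms(2) by (auto simp: eventually_at_filter abs_divide divide_le_eq)
  ultimately show ?thesis by (rule tendsto_upperbound) simp
qed

text \<open>The gradient at z is read off from one-parameter rotations. Rotating by the angles t u
  moves z by at most |t| |u|, so the derivative in direction u is at most |u|; inserting the
  gradient itself for u bounds its length by 1.\<close>

lemma trig_poly_gradient_bound:
  fixes a :: "('n::finite \<Rightarrow> int) \<Rightarrow> complex" and G :: "complex ^ 'n \<Rightarrow> real"
  assumes G: "\<And>z. z \<in> torus \<Longrightarrow> complex_of_real (G z) = (\<Sum>m\<in>B. a m * torus_char m z)"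
    and lip: "\<And>x y. x \<in> torus \<Longrightarrow> y \<in> torus \<Longrightarrow> G x - G y \<le> torus_dist x y"
    and z: "z \<in> torus"
  shows "(\<Sum>j\<in>UNIV. (norm (\<Sum>m\<in>B. (of_int (m j) * a m) * torus_char m z))\<^sup>2) \<le> 1"
proof -
  define c where "c m = a m * torus_char m z" for m
  define s where "s u m = (\<Sum>j\<in>UNIV. of_int (m j) * u j)" for u :: "'n \<Rightarrow> real" and m :: "'n \<Rightarrow> int"
  define p where "p u t = z * (\<chi> j. cis (t * u j))" for u :: "'n \<Rightarrow> real" and t
  have ct: "(\<chi> j. cis (t * u j)) \<in> torus" for t and u :: "'n \<Rightarrow> real" by (rule torusI) simp
  have pt: "p u t \<in> torus" for u t unfolding p_def using z ct by (rule torus_mult)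
  have Gp: "complex_of_real (G (p u t)) = (\<Sum>m\<in>B. c m * cis (t * s u m))" for u t
    by (subst G[OF pt]) (simp add: p_def torus_char_mult torus_char_cis c_def s_def sum_distrib_left mult_ac)
  have re: "G (p u t) = (\<Sum>m\<in>B. Re (c m) * cos (t * s u m) - Im (c m) * sin (t * s u m))" for u t
    using arg_cong[OF Gp[of u t], of Re] by simp
  have im: "0 = (\<Sum>m\<in>B. Re (c m) * sin (t * s u m) + Im (c m) * cos (t * s u m))" for u t
    using arg_cong[OF Gp[of u t], of Im] by simp
  \<comment> \<open>As \<open>G\<close> is real, the imaginary part of its expansion along the curve
    is identically zero, and so is its derivative.\<close>
  have Re0: "(\<Sum>m\<in>B. Re (c m) * s u m) = 0" for u
  proof -
    have "((\<lambda>t. \<Sum>m\<in>B. Re (c m) * sin (t * s u m) + Im (c m) * cos (t * s u m))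
        has_real_derivative (\<Sum>m\<in>B. Re (c m) * s u m)) (at 0)"
      by (auto intro!: derivative_eq_intros sum.cong)
    moreover have "((\<lambda>t. \<Sum>m\<in>B. Re (c m) * sin (t * s u m) + Im (c m) * cos (t * s u m))
        has_real_derivative 0) (at 0)"
      unfolding im[symmetric] by simp
    ultimately show ?thesis by (rule DERIV_unique)
  qed
  have Im0: "\<bar>\<Sum>m\<in>B. Im (c m) * s u m\<bar> \<le> sqrt (\<Sum>j\<in>UNIV. (u j)\<^sup>2)" for u
  proof -
    have "\<bar>\<Sum>m\<in>B. - (Im (c m) * s u m)\<bar> \<le> sqrt (\<Sum>j\<in>UNIV. (u j)\<^sup>2)"
    proof (rule DERIV_abs_le)
      show "((\<lambda>t. G (p u t)) has_real_derivative (\<Sum>m\<in>B. - (Im (c m) * s u m))) (at 0)"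
        unfolding re by (auto intro!: derivative_eq_intros sum.cong)
      fix t
      have "torus_dist (p u t) (p u 0) \<le> sqrt (\<Sum>j\<in>UNIV. (t * u j)\<^sup>2)"
        unfolding torus_dist_def
      proof (intro real_sqrt_le_mono sum_mono)
        fix j
        have n: "norm (z $ j) = 1" using z by (rule torus_norm)
        have "(z $ j * cis (t * u j)) * cnj (z $ j) = (z $ j * cnj (z $ j)) * cis (t * u j)"
          by (simp only: mult_ac)
        also have "z $ j * cnj (z $ j) = 1" by (simp add: complex_norm_square[symmetric] n)
        finally have eq: "(z $ j * cis (t * u j)) * cnj (z $ j) = cis (t * u j)" by simp
        have "arc_dist (p u t $ j) (p u 0 $ j) = \<bar>Arg ((z $ j * cis (t * u j)) * cnj (z $ j))\<bar>"
          using n by (simp add: p_def arc_dist_eq norm_mult)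
        then have "arc_dist (p u t $ j) (p u 0 $ j) = \<bar>Arg (cis (t * u j))\<bar>"
          unfolding eq .
        then have "\<bar>arc_dist (p u t $ j) (p u 0 $ j)\<bar> \<le> \<bar>t * u j\<bar>"
          using abs_Arg_cis_le[of "t * u j"] by simp
        then show "(arc_dist (p u t $ j) (p u 0 $ j))\<^sup>2 \<le> (t * u j)\<^sup>2"
          by (rule abs_le_square_iff[THEN iffD1])
      qed
      also have "\<dots> = sqrt (\<Sum>j\<in>UNIV. (u j)\<^sup>2) * \<bar>t\<bar>"
        by (simp add: power_mult_distrib real_sqrt_mult mult.commute flip: sum_distrib_left)
      finally show "\<bar>G (p u t) - G (p u 0)\<bar> \<le> sqrt (\<Sum>j\<in>UNIV. (u j)\<^sup>2) * \<bar>t\<bar>"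
        using lip[OF pt pt, of u t u 0] lip[OF pt pt, of u 0 u t] by (simp add: torus_dist_sym abs_le_iff)
    qed
    then show ?thesis by (simp add: sum_negf)
  qed
  \<comment> \<open>Minus the gradient of \<open>G\<close> at z; by \<open>Re0\<close> the formally
    differentiated sum is purely imaginary, so its modulus is that of \<open>v j\<close>.\<close>
  define v where "v j = (\<Sum>m\<in>B. Im (c m) * of_int (m j))" for j
  have grad: "(\<Sum>m\<in>B. (of_int (m j) * a m) * torus_char m z) = \<i> * of_real (v j)" for j
  proof -
    have sj: "s (\<lambda>i. if i = j then 1 else 0) m = of_int (m j)" for m
      by (simp add: s_def if_distrib[of "\<lambda>x. _ * x"] cong: if_cong)
    have "(\<Sum>m\<in>B. Re (c m) * of_int (m j)) = 0"
      using Re0[of "\<lambda>i. if i = j then 1 else 0"] by (simp add: sj)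
    moreover have "(\<Sum>m\<in>B. (of_int (m j) * a m) * torus_char m z) = (\<Sum>m\<in>B. of_real (of_int (m j)) * c m)"
      by (simp add: c_def mult_ac)
    ultimately show ?thesis
      by (simp add: complex_eq_iff v_def mult.commute)
  qed
  define V where "V = (\<Sum>j\<in>UNIV. (v j)\<^sup>2)"
  have "(\<Sum>m\<in>B. Im (c m) * s v m) = V"
  proof -
    have "(\<Sum>m\<in>B. Im (c m) * s v m) = (\<Sum>m\<in>B. \<Sum>j\<in>UNIV. Im (c m) * of_int (m j) * v j)"
      by (simp add: s_def sum_distrib_left mult_ac)
    also have "\<dots> = (\<Sum>j\<in>UNIV. v j * v j)"
      by (subst sum.swap) (simp add: v_def sum_distrib_right)
    finally show ?thesis by (simp add: V_def power2_eq_square)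
  qed
  \<comment> \<open>The direction u = v gives |v|^2 at most |v|.\<close>
  then have "V \<le> sqrt V" using Im0[of v] by (simp add: V_def)
  moreover have "V \<ge> 0" by (simp add: V_def sum_nonneg)
  ultimately have "V \<le> 1"
  proof (intro leI notI)
    assume "V \<le> sqrt V" "0 \<le> V" "1 < V"
    then have "sqrt V * 1 < sqrt V * sqrt V" by (intro mult_strict_left_mono) simp_all
    with \<open>V \<le> sqrt V\<close> \<open>0 \<le> V\<close> show False by simp
  qed
  then show ?thesis by (simp add: grad norm_mult V_def)
qed

theorem smooth_coeff_sum:
  fixes F :: "complex ^ 'n \<Rightarrow> real"
  assumes lip: "\<And>x y. x \<in> torus \<Longrightarrow> y \<in> torus \<Longrightarrow> F x - F y \<le> torus_dist x y"
  shows "(\<Sum>m\<in>freq_box n. (\<Sum>j\<in>UNIV. (of_int (m j))\<^sup>2) * (norm (smooth_coeff n F m))\<^sup>2) \<le> 1"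
proof -
  interpret prob_space "torus_measure :: (complex ^ 'n) measure" by (rule prob_space_torus_measure)
  note fm = finite_measure_axioms
  let ?a = "smooth_coeff n F"
  let ?D = "\<lambda>j z. \<Sum>m\<in>freq_box n. (of_int (m j) * ?a m) * torus_char m z"
  have F: "continuous_on torus F" using lip by (rule continuous_on_torus_lipschitz)
  have int: "integrable torus_measure (\<lambda>z. (norm (?D j z))\<^sup>2)" for j
    by (intro integrable_torus fm continuous_intros) auto
  have "(\<Sum>m\<in>freq_box n. (\<Sum>j\<in>UNIV. (of_int (m j))\<^sup>2) * (norm (?a m))\<^sup>2) =
      (\<Sum>j\<in>UNIV. \<Sum>m\<in>freq_box n. (norm (of_int (m j) * ?a m))\<^sup>2)"
    by (subst sum.swap) (simp add: sum_distrib_right norm_mult power_mult_distrib)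
  also have "\<dots> = (\<Sum>j\<in>UNIV. \<integral>z. (norm (?D j z))\<^sup>2 \<partial>torus_measure)"
    by (simp only: integral_torus_trig_poly[OF finite_freq_box])
  also have "\<dots> = (\<integral>z. (\<Sum>j\<in>UNIV. (norm (?D j z))\<^sup>2) \<partial>torus_measure)"
    by (rule Bochner_Integration.integral_sum[symmetric]) (rule int)
  also have "\<dots> \<le> (\<integral>z. 1 \<partial>(torus_measure :: (complex ^ 'n) measure))"
  proof (rule integral_mono)
    show "integrable torus_measure (\<lambda>z. \<Sum>j\<in>UNIV. (norm (?D j z))\<^sup>2)"
      using int by (intro Bochner_Integration.integrable_sum)
    fix z :: "complex ^ 'n" assume "z \<in> space torus_measure"
    then have z: "z \<in> torus" by simp
    show "(\<Sum>j\<in>UNIV. (norm (?D j z))\<^sup>2) \<le> 1"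
      by (rule trig_poly_gradient_bound[of "torus_smooth n F", OF torus_smooth_expansion[OF F] torus_smooth_lipschitz[OF lip] z])
  qed simp
  also have "\<dots> = 1" using prob_space by simp
  finally show ?thesis .
qed

section \<open>Fourier coefficients and the Wasserstein distance\<close>

lemma wasserstein1_torus_le_of_lipschitz:
  fixes M N :: "(complex ^ 'n) measure"
  assumes "prob_space M" "prob_space N" and M: "sets M = sets torus_borel" and N: "sets N = sets torus_borel"
    and dual: "\<And>F. (\<And>x y. x \<in> torus \<Longrightarrow> y \<in> torus \<Longrightarrow> F x - F y \<le> torus_dist x y) \<Longrightarrow>
      (\<integral>z. F z \<partial>M) - (\<integral>z. F z \<partial>N) \<le> C"
  shows "wasserstein1 torus_dist M N \<le> ennreal C"
proof (rule wasserstein1_le_of_lipschitz)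
  have sp: "space M = torus" using sets_eq_imp_space_eq[OF M] by simp
  show "(\<lambda>x. torus_dist x p) \<in> borel_measurable M" if "p \<in> space M" for p
  proof -
    have "continuous_on torus (\<lambda>x. torus_dist x p)"
    proof (rule continuous_on_torus_lipschitz)
      fix x y :: "complex ^ 'n" assume "x \<in> torus" "y \<in> torus"
      then show "torus_dist x p - torus_dist y p \<le> torus_dist x y"
        using torus_dist_triangle[of x y p] that by (simp add: sp)
    qed
    then show ?thesis using borel_measurable_torus by (simp cong: measurable_cong_sets add: M)
  qed
  show "\<exists>P. finite P \<and> P \<subseteq> space M \<and> (\<forall>x\<in>space M. \<exists>p\<in>P. torus_dist x p \<le> e)" if "0 < e" for e
    unfolding sp using that by (rule torus_net)
  show "torus_dist x z \<le> torus_dist x y + torus_dist y z"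
    if "x \<in> space M" "y \<in> space M" "z \<in> space M" for x y z
    using that unfolding sp by (rule torus_dist_triangle)
  show "(\<integral>z. F z \<partial>M) - (\<integral>z. F z \<partial>N) \<le> C"
    if "\<And>x y. x \<in> space M \<Longrightarrow> y \<in> space M \<Longrightarrow> F x - F y \<le> torus_dist x y" for F
    using that unfolding sp by (rule dual)
qed (use assms torus_dist_nonneg torus_dist_sym in auto)

definition torus_fourier :: "(complex ^ 'n) measure \<Rightarrow> ('n \<Rightarrow> int) \<Rightarrow> complex" where
  "torus_fourier M m = (\<integral>z. torus_char m z \<partial>M)"

lemma continuous_on_torus_char_id: "continuous_on torus (torus_char m)"
  using continuous_on_torus_char[of torus "\<lambda>z. z" m] by simp

lemma integral_torus_smooth:
  fixes F :: "complex ^ 'n \<Rightarrow> real"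
  assumes "prob_space M" and M: "sets M = sets torus_borel" and F: "continuous_on torus F"
  shows "complex_of_real (\<integral>z. torus_smooth n F z \<partial>M) = (\<Sum>m\<in>freq_box n. smooth_coeff n F m * torus_fourier M m)"
proof -
  interpret prob_space M by fact
  have sp: "space M = torus" using sets_eq_imp_space_eq[OF M] by simp
  have "integrable M (torus_char m)" for m
    by (rule integrable_torus[OF finite_measure_axioms M continuous_on_torus_char_id])
  then have int: "integrable M (\<lambda>z. c * torus_char m z)" for c m
    by (rule integrable_mult_right)
  have "complex_of_real (\<integral>z. torus_smooth n F z \<partial>M) = (\<integral>z. complex_of_real (torus_smooth n F z) \<partial>M)"
    by (rule integral_complex_of_real[symmetric])
  also have "\<dots> = (\<integral>z. (\<Sum>m\<in>freq_box n. smooth_coeff n F m * torus_char m z) \<partial>M)"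
    by (intro Bochner_Integration.integral_cong refl torus_smooth_expansion[OF F]) (simp add: sp)
  also have "\<dots> = (\<Sum>m\<in>freq_box n. \<integral>z. smooth_coeff n F m * torus_char m z \<partial>M)"
    by (rule Bochner_Integration.integral_sum) (rule int)
  also have "\<dots> = (\<Sum>m\<in>freq_box n. smooth_coeff n F m * torus_fourier M m)"
    by (simp add: torus_fourier_def)
  finally show ?thesis .
qed

text \<open>Valid for any two probability measures on the torus; the curve enters later, through its
  Fourier coefficients. Both integrals pay the smoothing error once, which doubles the constant of
  \<open>torus_smooth_close\<close>.\<close>

theorem wasserstein1_torus_le_fourier:
  fixes M N :: "(complex ^ 'n) measure"
  assumes PM: "prob_space M" and PN: "prob_space N"
    and M: "sets M = sets torus_borel" and N: "sets N = sets torus_borel"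
  shows "wasserstein1 torus_dist M N \<le> ennreal (4 * sqrt 3 * sqrt (real CARD('n)) / (real n + 1) +
    sqrt (\<Sum>m\<in>freq_box n - {\<lambda>_. 0}.
      (norm (torus_fourier M m - torus_fourier N m))\<^sup>2 / (\<Sum>j\<in>UNIV. (of_int (m j))\<^sup>2)))"
proof (rule wasserstein1_torus_le_of_lipschitz[OF PM PN M N])
  fix F :: "complex ^ 'n \<Rightarrow> real"
  assume lip: "\<And>x y. x \<in> torus \<Longrightarrow> y \<in> torus \<Longrightarrow> F x - F y \<le> torus_dist x y"
  interpret M: prob_space M by fact
  interpret N: prob_space N by fact
  have spM: "space M = torus" and spN: "space N = torus"
    using sets_eq_imp_space_eq[OF M] sets_eq_imp_space_eq[OF N] by simp_all
  let ?G = "torus_smooth n F" and ?a = "smooth_coeff n F" and ?B = "freq_box n - {\<lambda>_::'n. 0::int}"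
  define c where "c = 2 * sqrt 3 * sqrt (real CARD('n)) / (real n + 1)"
  define \<Delta> where "\<Delta> m = norm (torus_fourier M m - torus_fourier N m)" for m
  define r where "r m = sqrt (\<Sum>j\<in>UNIV. (of_int (m j))\<^sup>2)" for m :: "'n \<Rightarrow> int"
  have F: "continuous_on torus F" using lip by (rule continuous_on_torus_lipschitz)
  have G: "continuous_on torus ?G"
    by (rule continuous_on_torus_lipschitz) (rule torus_smooth_lipschitz[OF lip])
  have close: "\<bar>F z - ?G z\<bar> \<le> c" if "z \<in> torus" for z
    unfolding c_def using lip that by (rule torus_smooth_close)
  have iM: "integrable M F" "integrable M ?G"
    using integrable_torus[OF M.finite_measure_axioms M] F G by auto
  have iN: "integrable N F" "integrable N ?G"
    using integrable_torus[OF N.finite_measure_axioms N] F G by auto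
  have "(\<integral>z. F z \<partial>M) \<le> (\<integral>z. ?G z + c \<partial>M)"
    using iM close by (intro integral_mono) (auto simp: spM abs_le_iff algebra_simps)
  moreover have "(\<integral>z. ?G z - c \<partial>N) \<le> (\<integral>z. F z \<partial>N)"
    using iN close by (intro integral_mono) (auto simp: spN abs_le_iff algebra_simps)
  ultimately have 1: "(\<integral>z. F z \<partial>M) - (\<integral>z. F z \<partial>N) \<le> 2 * c + ((\<integral>z. ?G z \<partial>M) - (\<integral>z. ?G z \<partial>N))"
    using iM iN by (simp add: M.prob_space N.prob_space)
  \<comment> \<open>Probability measures agree at frequency 0, so it drops out; the weight
    \<open>r m\<close>, by which the next estimate divides, would vanish there.\<close>
  have zero: "torus_fourier M (\<lambda>_. 0) = 1" "torus_fourier N (\<lambda>_. 0) = 1"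
    by (simp_all add: torus_fourier_def torus_char_def M.prob_space N.prob_space)
  have "complex_of_real ((\<integral>z. ?G z \<partial>M) - (\<integral>z. ?G z \<partial>N)) =
      (\<Sum>m\<in>freq_box n. ?a m * (torus_fourier M m - torus_fourier N m))"
    unfolding of_real_diff integral_torus_smooth[OF PM M F] integral_torus_smooth[OF PN N F]
    by (simp add: sum_subtractf right_diff_distrib)
  also have "\<dots> = (\<Sum>m\<in>?B. ?a m * (torus_fourier M m - torus_fourier N m))"
    by (intro sum.mono_neutral_right finite_freq_box) (auto simp: zero)
  finally have "\<bar>(\<integral>z. ?G z \<partial>M) - (\<integral>z. ?G z \<partial>N)\<bar> = norm (\<Sum>m\<in>?B. ?a m * (torus_fourier M m - torus_fourier N m))"
    by (metis norm_of_real)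
  also have "\<dots> \<le> (\<Sum>m\<in>?B. norm (?a m) * \<Delta> m)"
    by (rule sum_norm_le) (simp add: norm_mult \<Delta>_def)
  \<comment> \<open>Cauchy-Schwarz with the weight \<open>r m\<close>, so that the first factor is
    the one controlled by \<open>smooth_coeff_sum\<close>.\<close>
  also have "\<dots> = (\<Sum>m\<in>?B. \<bar>r m * norm (?a m)\<bar> * \<bar>\<Delta> m / r m\<bar>)"
  proof (rule sum.cong)
    fix m assume "m \<in> ?B"
    then obtain i where "m i \<noteq> 0" by auto
    then have "0 < (\<Sum>j\<in>UNIV. (of_int (m j) :: real)\<^sup>2)"
      by (intro sum_pos2[of UNIV i]) auto
    then have "r m > 0" by (simp add: r_def)
    then show "norm (?a m) * \<Delta> m = \<bar>r m * norm (?a m)\<bar> * \<bar>\<Delta> m / r m\<bar>"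
      by (simp add: \<Delta>_def abs_mult)
  qed simp
  also have "\<dots> \<le> L2_set (\<lambda>m. r m * norm (?a m)) ?B * L2_set (\<lambda>m. \<Delta> m / r m) ?B"
    by (rule L2_set_mult_ineq)
  also have "\<dots> \<le> 1 * L2_set (\<lambda>m. \<Delta> m / r m) ?B"
  proof (rule mult_right_mono)
    have "(\<Sum>m\<in>?B. (r m * norm (?a m))\<^sup>2) \<le> (\<Sum>m\<in>freq_box n. (r m * norm (?a m))\<^sup>2)"
      by (intro sum_mono2 finite_freq_box) auto
    also have "\<dots> \<le> 1"
      using smooth_coeff_sum[OF lip, of n] by (simp add: r_def power_mult_distrib sum_nonneg)
    finally show "L2_set (\<lambda>m. r m * norm (?a m)) ?B \<le> 1" by (simp add: L2_set_def)
  qed (rule L2_set_nonneg)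
  also have "1 * L2_set (\<lambda>m. \<Delta> m / r m) ?B =
      sqrt (\<Sum>m\<in>?B. (\<Delta> m)\<^sup>2 / (\<Sum>j\<in>UNIV. (of_int (m j))\<^sup>2))"
    by (simp add: L2_set_def power_divide r_def sum_nonneg)
  finally have "(\<integral>z. ?G z \<partial>M) - (\<integral>z. ?G z \<partial>N) \<le> sqrt (\<Sum>m\<in>?B. (\<Delta> m)\<^sup>2 / (\<Sum>j\<in>UNIV. (of_int (m j))\<^sup>2))"
    by simp
  with 1 show "(\<integral>z. F z \<partial>M) - (\<integral>z. F z \<partial>N) \<le> 4 * sqrt 3 * sqrt (real CARD('n)) / (real n + 1) +
    sqrt (\<Sum>m\<in>?B. (norm (torus_fourier M m - torus_fourier N m))\<^sup>2 / (\<Sum>j\<in>UNIV. (of_int (m j))\<^sup>2))"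
    by (simp add: c_def \<Delta>_def)
qed

section \<open>The curve, its closure and the Haar measure\<close>

definition freq_vec :: "('n \<Rightarrow> int) \<Rightarrow> real ^ 'n" where
  "freq_vec m = (\<chi> j. of_int (m j))"

lemma exp_curve_eq: "exp_curve \<gamma> x = (\<chi> j. cis (x * \<gamma> $ j))"
  by (simp add: exp_curve_def cis_conv_exp)

lemma exp_curve_in_torus: "exp_curve \<gamma> x \<in> torus"
  by (rule torusI) (simp add: exp_curve_eq)

lemma exp_curve_add: "exp_curve \<gamma> (x + y) = exp_curve \<gamma> x * exp_curve \<gamma> y"
  by (simp add: exp_curve_eq vec_eq_iff cis_mult distrib_right)

lemma exp_curve_0: "exp_curve \<gamma> 0 = 1"
  by (simp add: exp_curve_eq vec_eq_iff)

lemma torus_char_exp_curve: "torus_char m (exp_curve \<gamma> x) = cis (x * (freq_vec m \<bullet> \<gamma>))"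
  by (simp add: exp_curve_eq torus_char_cis freq_vec_def inner_vec_def sum_distrib_left mult_ac)

lemma group_torus_group: "group (torus_group :: (complex ^ 'n) monoid)"
proof (rule groupI)
  fix z :: "complex ^ 'n" assume "z \<in> carrier torus_group"
  then have z: "z \<in> torus" by (simp add: torus_group_def)
  have "torus_cnj z * (z * 1) = 1" using z by (rule torus_cnj_mult_cancel)
  then show "\<exists>y\<in>carrier torus_group. y \<otimes>\<^bsub>torus_group\<^esub> z = \<one>\<^bsub>torus_group\<^esub>"
    using torus_cnj_in_torus[OF z] by (auto simp: torus_group_def vec_eq_iff)
next
  show "\<one>\<^bsub>torus_group\<^esub> \<in> carrier (torus_group :: (complex ^ 'n) monoid)"
    by (simp add: torus_group_def torus_def)
qed (auto simp: torus_group_def torus_mult vec_eq_iff mult.assoc)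

text \<open>The curve is the image of the additive group of the reals under a homomorphism, hence
  already a subgroup.\<close>

lemma generate_exp_curve: "generate torus_group (range (exp_curve \<gamma>)) = range (exp_curve \<gamma>)"
proof (intro equalityI subsetI)
  fix z assume "z \<in> generate torus_group (range (exp_curve \<gamma>))"
  then show "z \<in> range (exp_curve \<gamma>)"
  proof induction
    case one
    have "\<one>\<^bsub>torus_group\<^esub> = exp_curve \<gamma> 0" by (simp add: torus_group_def exp_curve_0)
    then show ?case by (rule range_eqI)
  next
    case (inv h)
    then obtain x where h: "h = exp_curve \<gamma> x" by auto
    have "inv\<^bsub>torus_group\<^esub> h = exp_curve \<gamma> (- x)"
      unfolding h using exp_curve_add[of \<gamma> "- x" x] exp_curve_in_torus
      by (intro group.inv_equality[OF group_torus_group]) (simp_all add: torus_group_def exp_curve_0)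
    then show ?case by (rule range_eqI)
  next
    case (eng h1 h2)
    then obtain x y where "h1 = exp_curve \<gamma> x" "h2 = exp_curve \<gamma> y" by auto
    then have "h1 \<otimes>\<^bsub>torus_group\<^esub> h2 = exp_curve \<gamma> (x + y)"
      by (simp add: torus_group_def exp_curve_add)
    then show ?case by (rule range_eqI)
  qed auto
qed (auto intro: generate.incl)

lemma carrier_closure_group: "carrier (closure_group \<gamma>) = closure (range (exp_curve \<gamma>))"
  by (simp add: closure_group_def generate_exp_curve)

lemma closure_exp_curve_subset_torus: "closure (range (exp_curve \<gamma>)) \<subseteq> torus"
  by (rule closure_minimal) (auto simp: exp_curve_in_torus closed_torus)

text \<open>Translation by a point of the curve is continuous and maps the curve into itself. These
  are the translations to which invariance of the Haar measure is applied.\<close>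

lemma closure_exp_curve_translate:
  assumes "z \<in> closure (range (exp_curve \<gamma>))"
  shows "exp_curve \<gamma> x * z \<in> closure (range (exp_curve \<gamma>))"
proof -
  have "(\<lambda>z. exp_curve \<gamma> x * z) ` closure (range (exp_curve \<gamma>)) \<subseteq> closure (range (exp_curve \<gamma>))"
  proof (rule image_closure_subset)
    show "continuous_on (closure (range (exp_curve \<gamma>))) (\<lambda>z. exp_curve \<gamma> x * z)"
      by (intro continuous_intros)
    show "(\<lambda>z. exp_curve \<gamma> x * z) ` range (exp_curve \<gamma>) \<subseteq> closure (range (exp_curve \<gamma>))"
      by (auto simp: exp_curve_add[symmetric] intro!: subsetD[OF closure_subset])
  qed simp
  then show ?thesis using assms by blast
qed

lemma torus_char_closure_exp_curve:
  assumes "freq_vec m \<bullet> \<gamma> = 0" and z: "z \<in> closure (range (exp_curve \<gamma>))"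
  shows "torus_char m z = 1"
proof (rule continuous_constant_on_closure[OF _ _ z])
  show "continuous_on (closure (range (exp_curve \<gamma>))) (torus_char m)"
    using continuous_on_torus_char_id closure_exp_curve_subset_torus by (rule continuous_on_subset)
  show "torus_char m w = 1" if "w \<in> range (exp_curve \<gamma>)" for w
    using that assms(1) by (auto simp: torus_char_exp_curve)
qed

text \<open>A character that is 1 on the curve is 1 on its closure; any other is negated by
  translation with a suitable point of the curve, so its integral vanishes. The image under the
  identity is the measure seen on the whole torus.\<close>

lemma torus_fourier_haar:
  fixes \<gamma> :: "real ^ 'n"
  assumes haar: "haar_prob_measure (closure_group \<gamma>) L"
  shows "prob_space (distr L torus_borel (\<lambda>z. z))"
    and "torus_fourier (distr L torus_borel (\<lambda>z. z)) m = (if freq_vec m \<bullet> \<gamma> = 0 then 1 else 0)"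
proof -
  let ?C = "closure (range (exp_curve \<gamma>))"
  interpret L: prob_space L using haar by (simp add: haar_prob_measure_def)
  have sets: "sets L = sets (restrict_space borel ?C)"
    using haar by (simp add: haar_prob_measure_def carrier_closure_group)
  have sp: "space L = ?C" using sets_eq_imp_space_eq[OF sets] by (simp add: space_restrict_space)
  have id: "(\<lambda>z. z) \<in> measurable L torus_borel"
  proof -
    have "(\<lambda>z. z) \<in> measurable (restrict_space borel ?C) (restrict_space borel torus)"
      using closure_exp_curve_subset_torus by (intro measurable_restrict_space3) auto
    then show ?thesis by (simp cong: measurable_cong_sets add: sets torus_borel_def)
  qed
  then show "prob_space (distr L torus_borel (\<lambda>z. z))" by (rule L.prob_space_distr)
  have tf: "torus_fourier (distr L torus_borel (\<lambda>z. z)) m = (\<integral>z. torus_char m z \<partial>L)"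
    unfolding torus_fourier_def
    by (rule integral_distr[OF id borel_measurable_torus[OF continuous_on_torus_char_id]])
  show "torus_fourier (distr L torus_borel (\<lambda>z. z)) m = (if freq_vec m \<bullet> \<gamma> = 0 then 1 else 0)"
  proof (cases "freq_vec m \<bullet> \<gamma> = 0")
    case True
    have "(\<integral>z. torus_char m z \<partial>L) = (\<integral>z. 1 \<partial>L)"
      using torus_char_closure_exp_curve[OF True] by (intro Bochner_Integration.integral_cong) (auto simp: sp)
    then show ?thesis using True tf L.prob_space by simp
  next
    case False
    \<comment> \<open>Chosen so that the character takes the value cis pi = -1 at
      \<open>?g\<close>.\<close>
    define x where "x = pi / (freq_vec m \<bullet> \<gamma>)"
    let ?g = "exp_curve \<gamma> x" and ?h = "exp_curve \<gamma> (- x)"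
    have hg: "?h * (?g * z) = z" "?g * (?h * z) = z" for z
      using exp_curve_add[of \<gamma> "- x" x] exp_curve_add[of \<gamma> x "- x"]
      by (simp_all add: exp_curve_0 vec_eq_iff flip: mult.assoc)
    have gm: "(\<lambda>z. ?g * z) \<in> measurable L L"
    proof -
      have "(\<lambda>z. ?g * z) \<in> measurable (restrict_space borel ?C) (restrict_space borel ?C)"
      proof (rule measurable_restrict_space3)
        show "(\<lambda>z. ?g * z) \<in> borel_measurable borel"
          by (intro borel_measurable_continuous_onI continuous_intros)
      qed (use closure_exp_curve_translate in auto)
      then show ?thesis by (simp cong: measurable_cong_sets add: sets)
    qed
    have "distr L L (\<lambda>z. ?g * z) = L"
    proof (rule measure_eqI)
      fix A assume "A \<in> sets (distr L L (\<lambda>z. ?g * z))"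
      then have A: "A \<in> sets L" by simp
      have AC: "A \<subseteq> ?C" using sets.sets_into_space[OF A] by (simp add: sp)
      \<comment> \<open>Invariance is stated for cosets, the image measure is defined by preimages;
        the preimage under multiplication by \<open>?g\<close> is the coset of its inverse
        \<open>?h\<close>.\<close>
      have "(\<lambda>z. ?g * z) -` A \<inter> space L = ?h <#\<^bsub>closure_group \<gamma>\<^esub> A"
      proof (intro equalityI subsetI)
        fix z assume "z \<in> (\<lambda>z. ?g * z) -` A \<inter> space L"
        then have "?g * z \<in> A" by simp
        moreover have "z = ?h * (?g * z)" by (simp add: hg)
        ultimately show "z \<in> ?h <#\<^bsub>closure_group \<gamma>\<^esub> A"
          unfolding l_coset_def closure_group_def torus_group_def by auto
      next
        fix z assume "z \<in> ?h <#\<^bsub>closure_group \<gamma>\<^esub> A"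
        then obtain a where "a \<in> A" "z = ?h * a"
          by (auto simp: l_coset_def closure_group_def torus_group_def)
        then show "z \<in> (\<lambda>z. ?g * z) -` A \<inter> space L"
          using AC closure_exp_curve_translate[of a \<gamma> "- x"] by (auto simp: hg sp)
      qed
      moreover have "?h \<in> carrier (closure_group \<gamma>)"
        by (auto simp: carrier_closure_group intro!: subsetD[OF closure_subset])
      ultimately show "emeasure (distr L L (\<lambda>z. ?g * z)) A = emeasure L A"
        using haar A gm by (simp add: emeasure_distr haar_prob_measure_def)
    qed simp
    then have "(\<integral>z. torus_char m z \<partial>L) = (\<integral>z. torus_char m z \<partial>distr L L (\<lambda>z. ?g * z))" by simp
    also have "\<dots> = (\<integral>z. torus_char m (?g * z) \<partial>L)"
    proof (rule integral_distr[OF gm])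
      show "torus_char m \<in> borel_measurable L"
        using measurable_compose[OF id borel_measurable_torus[OF continuous_on_torus_char_id]] .
    qed
    also have "\<dots> = - (\<integral>z. torus_char m z \<partial>L)"
      using False by (simp add: torus_char_mult torus_char_exp_curve x_def)
    finally show ?thesis using False tf by simp
  qed
qed

section \<open>Oscillatory integrals, the lattice sum and the final bound\<close>

text \<open>A primitive of modulus 1 / |s| leaves two boundary terms, whatever the length of the
  interval; this is the source of the factor 2 in the second term of the theorem.\<close>

lemma norm_integral_cis_le:
  assumes "s \<noteq> 0" "a \<le> b"
  shows "norm (integral {a..b} (\<lambda>x. cis (x * s))) \<le> 2 / \<bar>s\<bar>"
proof -
  define P where "P x = exp (\<i> * of_real s * of_real x) / (\<i> * of_real s)" for x :: real
  have "((\<lambda>x. cis (x * s)) has_integral P b - P a) {a..b}"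
  proof (rule fundamental_theorem_of_calculus[OF assms(2)])
    fix x
    have "((\<lambda>z. exp (\<i> * of_real s * z) / (\<i> * of_real s)) has_field_derivative exp (\<i> * of_real s * of_real x))
        (at (of_real x))"
      using assms(1) by (auto intro!: derivative_eq_intros)
    then have "(P has_vector_derivative exp (\<i> * of_real s * of_real x)) (at x within {a..b})"
      unfolding P_def by (rule has_vector_derivative_real_field)
    then show "(P has_vector_derivative cis (x * s)) (at x within {a..b})"
      by (simp add: cis_conv_exp mult_ac)
  qed
  then have "integral {a..b} (\<lambda>x. cis (x * s)) = P b - P a" by (rule integral_unique)
  also have "norm \<dots> \<le> norm (P b) + norm (P a)" by (rule norm_triangle_ineq4)
  also have "\<dots> = 2 / \<bar>s\<bar>" by (simp add: P_def norm_divide norm_mult)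
  finally show ?thesis .
qed

text \<open>A frequency with nonzero inner product is nonzero, and a nonzero integer vector has sup
  norm at least 1, so the lower bound comes for free. Since \<open>freq_box\<close> is finite, the
  index set of the sum in the theorem is finite too, and the sum is not the default 0 of an infinite
  one.\<close>

lemma freq_vec_image:
  fixes \<gamma> :: "real ^ 'n"
  assumes "1 \<le> H"
  shows "bij_betw freq_vec {m \<in> freq_box (nat \<lfloor>H\<rfloor>). freq_vec m \<bullet> \<gamma> \<noteq> 0}
    {m \<in> int_lattice. 1 \<le> infnorm m \<and> infnorm m \<le> H \<and> m \<bullet> \<gamma> \<noteq> 0}"
proof (intro bij_betw_imageI equalityI subsetI)
  show "inj_on freq_vec {m \<in> freq_box (nat \<lfloor>H\<rfloor>). freq_vec m \<bullet> \<gamma> \<noteq> 0}"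
    by (auto simp: inj_on_def freq_vec_def vec_eq_iff fun_eq_iff)
next
  fix v assume "v \<in> freq_vec ` {m \<in> freq_box (nat \<lfloor>H\<rfloor>). freq_vec m \<bullet> \<gamma> \<noteq> 0}"
  then obtain m where v: "v = freq_vec m" and m: "m \<in> freq_box (nat \<lfloor>H\<rfloor>)" "freq_vec m \<bullet> \<gamma> \<noteq> 0" by auto
  have "\<exists>i. m i \<noteq> 0"
  proof (rule ccontr)
    assume "\<nexists>i. m i \<noteq> 0"
    then have "freq_vec m = 0" by (simp add: freq_vec_def vec_eq_iff)
    then show False using m by simp
  qed
  then obtain i where "m i \<noteq> 0" ..
  then have "1 \<le> \<bar>v $ i\<bar>" by (simp add: v freq_vec_def flip: of_int_abs)
  then have "1 \<le> infnorm v" using component_le_infnorm_cart[of v i] by simp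
  moreover have "infnorm v \<le> H"
    unfolding infnorm_cart
  proof (rule cSup_least)
    fix y assume "y \<in> {\<bar>v $ i\<bar> |i. i \<in> UNIV}"
    then obtain j where y: "y = \<bar>v $ j\<bar>" by auto
    have "\<bar>m j\<bar> \<le> \<lfloor>H\<rfloor>" using m(1) assms by (simp add: freq_box_iff)
    then show "y \<le> H" by (simp add: y v freq_vec_def le_floor_iff flip: of_int_abs)
  qed auto
  ultimately show "v \<in> {m \<in> int_lattice. 1 \<le> infnorm m \<and> infnorm m \<le> H \<and> m \<bullet> \<gamma> \<noteq> 0}"
    using m by (simp add: v int_lattice_def freq_vec_def)
next
  fix v assume v: "v \<in> {m \<in> int_lattice. 1 \<le> infnorm m \<and> infnorm m \<le> H \<and> m \<bullet> \<gamma> \<noteq> 0}"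
  define m where "m j = \<lfloor>v $ j\<rfloor>" for j
  have mv: "v = freq_vec m" using v by (auto simp: freq_vec_def m_def vec_eq_iff int_lattice_def)
  have "\<bar>m j\<bar> \<le> \<lfloor>H\<rfloor>" for j
  proof -
    have "\<bar>v $ j\<bar> \<le> H" using component_le_infnorm_cart[of v j] v by simp
    then show ?thesis by (simp add: mv freq_vec_def le_floor_iff flip: of_int_abs)
  qed
  then have "m \<in> freq_box (nat \<lfloor>H\<rfloor>)" using assms by (simp add: freq_box_iff)
  then show "v \<in> freq_vec ` {m \<in> freq_box (nat \<lfloor>H\<rfloor>). freq_vec m \<bullet> \<gamma> \<noteq> 0}" using v mv by auto
qed

theorem theorem3p4:
  fixes \<gamma> :: "real ^ 'n"
    and lambda_c :: "(complex ^ 'n) measure"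
    and x0 :: real
    and \<nu> :: "real \<Rightarrow> (complex ^ 'n) measure"
  assumes haar: "haar_prob_measure (closure_group \<gamma>) lambda_c"
    and x0: "x0 > 0"
    and nu_prob: "\<And>X. X > x0 \<Longrightarrow> prob_space (\<nu> X)"
    and nu_sets: "\<And>X. X > x0 \<Longrightarrow> sets (\<nu> X) = sets torus_borel"
    and nu_integral: "\<And>X (h :: complex ^ 'n \<Rightarrow> complex).
      X > x0 \<Longrightarrow> continuous_on torus h \<Longrightarrow>
      (\<integral>z. h z \<partial>\<nu> X) = (1 / (X - x0)) *\<^sub>R integral {x0..X} (\<lambda>x. h (exp_curve \<gamma> x))"
  shows "\<forall>X>x0. \<forall>H\<ge>1::real.
    wasserstein1 torus_dist (\<nu> X) (distr lambda_c torus_borel (\<lambda>z. z)) \<le>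
      ennreal (4 * sqrt 3 * sqrt (real CARD('n)) / H +
        2 / (X - x0) *
          sqrt (\<Sum>m | m \<in> int_lattice \<and> 1 \<le> infnorm m \<and> infnorm m \<le> H \<and> m \<bullet> \<gamma> \<noteq> 0.
            1 / ((norm m)\<^sup>2 * (m \<bullet> \<gamma>)\<^sup>2)))"
proof (intro allI impI)
  fix X H :: real assume X: "x0 < X" and H: "1 \<le> H"
  \<comment> \<open>The degree may not exceed H, so that all frequencies stay in the range of the
    sum, while the smoothing error is governed by n + 1; the floor serves both.\<close>
  define n where "n = nat \<lfloor>H\<rfloor>"
  have n: "H \<le> real n + 1" using H by (simp add: n_def)
  let ?N = "distr lambda_c torus_borel (\<lambda>z. z)"
  let ?L = "{m \<in> int_lattice. 1 \<le> infnorm m \<and> infnorm m \<le> H \<and> m \<bullet> \<gamma> \<noteq> 0}"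
  define B where "B = {m \<in> freq_box n. freq_vec m \<bullet> \<gamma> \<noteq> 0}"
  define \<Delta> where "\<Delta> m = norm (torus_fourier (\<nu> X) m - torus_fourier ?N m)" for m
  have nrm: "(\<Sum>j\<in>UNIV. (of_int (m j))\<^sup>2) = (norm (freq_vec m))\<^sup>2" for m :: "'n \<Rightarrow> int"
    unfolding power2_norm_eq_inner by (simp add: inner_vec_def freq_vec_def power2_eq_square)
  have nu: "torus_fourier (\<nu> X) m = (1 / (X - x0)) *\<^sub>R integral {x0..X} (\<lambda>x. cis (x * (freq_vec m \<bullet> \<gamma>)))" for m
    unfolding torus_fourier_def nu_integral[OF X continuous_on_torus_char_id] torus_char_exp_curve ..
  have \<Delta>0: "\<Delta> m = 0" if "freq_vec m \<bullet> \<gamma> = 0" for m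
    using that X by (simp add: \<Delta>_def nu torus_fourier_haar(2)[OF haar] scaleR_conv_of_real)
  have \<Delta>1: "\<Delta> m \<le> 2 / (X - x0) / \<bar>freq_vec m \<bullet> \<gamma>\<bar>" if "freq_vec m \<bullet> \<gamma> \<noteq> 0" for m
  proof -
    have "\<Delta> m = 1 / (X - x0) * norm (integral {x0..X} (\<lambda>x. cis (x * (freq_vec m \<bullet> \<gamma>))))"
      using that X by (simp add: \<Delta>_def nu torus_fourier_haar(2)[OF haar])
    also have "\<dots> \<le> 1 / (X - x0) * (2 / \<bar>freq_vec m \<bullet> \<gamma>\<bar>)"
      using that X by (intro mult_left_mono norm_integral_cis_le) auto
    finally show ?thesis by simp
  qed
  \<comment> \<open>All terms orthogonal to \<open>\<gamma>\<close> vanish by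
    \<open>\<Delta>0\<close>. Frequency 0 is itself orthogonal to \<open>\<gamma>\<close>, so
    \<open>B\<close> excludes it without saying so.\<close>
  have "(\<Sum>m\<in>freq_box n - {\<lambda>_. 0}. (\<Delta> m)\<^sup>2 / (\<Sum>j\<in>UNIV. (of_int (m j))\<^sup>2)) =
      (\<Sum>m\<in>B. (\<Delta> m)\<^sup>2 / (norm (freq_vec m))\<^sup>2)"
    unfolding nrm using \<Delta>0 finite_freq_box
    by (intro sum.mono_neutral_right) (auto simp: B_def freq_vec_def inner_vec_def)
  also have "\<dots> \<le> (\<Sum>m\<in>B. (2 / (X - x0))\<^sup>2 * (1 / ((norm (freq_vec m))\<^sup>2 * (freq_vec m \<bullet> \<gamma>)\<^sup>2)))"
  proof (rule sum_mono)
    fix m assume "m \<in> B"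
    then have "\<Delta> m \<le> 2 / (X - x0) / \<bar>freq_vec m \<bullet> \<gamma>\<bar>" using \<Delta>1 by (simp add: B_def)
    then have "(\<Delta> m)\<^sup>2 \<le> (2 / (X - x0) / \<bar>freq_vec m \<bullet> \<gamma>\<bar>)\<^sup>2"
      by (rule power_mono) (simp add: \<Delta>_def)
    then have "(\<Delta> m)\<^sup>2 / (norm (freq_vec m))\<^sup>2 \<le> (2 / (X - x0) / \<bar>freq_vec m \<bullet> \<gamma>\<bar>)\<^sup>2 / (norm (freq_vec m))\<^sup>2"
      by (rule divide_right_mono) simp
    then show "(\<Delta> m)\<^sup>2 / (norm (freq_vec m))\<^sup>2 \<le> (2 / (X - x0))\<^sup>2 * (1 / ((norm (freq_vec m))\<^sup>2 * (freq_vec m \<bullet> \<gamma>)\<^sup>2))"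
      by (simp add: power_divide power_mult_distrib mult_ac)
  qed
  also have "\<dots> = (2 / (X - x0))\<^sup>2 * (\<Sum>m\<in>?L. 1 / ((norm m)\<^sup>2 * (m \<bullet> \<gamma>)\<^sup>2))"
    using sum.reindex_bij_betw[OF freq_vec_image[OF H, of \<gamma>], of "\<lambda>m. 1 / ((norm m)\<^sup>2 * (m \<bullet> \<gamma>)\<^sup>2)"]
    unfolding B_def n_def sum_distrib_left[symmetric] by simp
  finally have "sqrt (\<Sum>m\<in>freq_box n - {\<lambda>_. 0}. (\<Delta> m)\<^sup>2 / (\<Sum>j\<in>UNIV. (of_int (m j))\<^sup>2)) \<le>
      2 / (X - x0) * sqrt (\<Sum>m\<in>?L. 1 / ((norm m)\<^sup>2 * (m \<bullet> \<gamma>)\<^sup>2))"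
    using X real_sqrt_le_mono by (fastforce simp: real_sqrt_mult)
  moreover have "4 * sqrt 3 * sqrt (real CARD('n)) / (real n + 1) \<le> 4 * sqrt 3 * sqrt (real CARD('n)) / H"
    using n H by (intro divide_left_mono) auto
  ultimately have "ennreal (4 * sqrt 3 * sqrt (real CARD('n)) / (real n + 1) +
      sqrt (\<Sum>m\<in>freq_box n - {\<lambda>_. 0}. (\<Delta> m)\<^sup>2 / (\<Sum>j\<in>UNIV. (of_int (m j))\<^sup>2))) \<le>
    ennreal (4 * sqrt 3 * sqrt (real CARD('n)) / H +
      2 / (X - x0) * sqrt (\<Sum>m\<in>?L. 1 / ((norm m)\<^sup>2 * (m \<bullet> \<gamma>)\<^sup>2)))"
    by (intro ennreal_leI add_mono)
  moreover have "wasserstein1 torus_dist (\<nu> X) ?N \<le>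
    ennreal (4 * sqrt 3 * sqrt (real CARD('n)) / (real n + 1) +
      sqrt (\<Sum>m\<in>freq_box n - {\<lambda>_. 0}. (\<Delta> m)\<^sup>2 / (\<Sum>j\<in>UNIV. (of_int (m j))\<^sup>2)))"
    unfolding \<Delta>_def using nu_prob[OF X] torus_fourier_haar(1)[OF haar] nu_sets[OF X]
    by (intro wasserstein1_torus_le_fourier) simp_all
  ultimately show "wasserstein1 torus_dist (\<nu> X) ?N \<le>
    ennreal (4 * sqrt 3 * sqrt (real CARD('n)) / H +
      2 / (X - x0) * sqrt (\<Sum>m\<in>?L. 1 / ((norm m)\<^sup>2 * (m \<bullet> \<gamma>)\<^sup>2)))"
    by (rule order_trans[rotated])
qed

end
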